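(* Let $1\leq m<n$ be integers and let $\theta\in(0,1)$. For a non-empty set $F\subseteq\mathbb{R}^n$ write $$\Delta(F)=\max\big\{0,\ \overline{\dim}_{\mathrm A}^{\theta}F-m,\ (\dim_{\mathrm A}F-m)(1-\theta)\big\}.$$ (a) If $F\subseteq\mathbb{R}^n$ is bounded then, for almost all $V\in G(n,m)$, $$\overline{\dim}_{\mathrm B}\,\pi_V F\ \geq\ \overline{\dim}_{\mathrm B}F-\Delta(F),$$ and likewise, for almost all $V\in G(n,m)$, $\underline{\dim}_{\mathrm B}\,\pi_V F\geq\underline{\dim}_{\mathrm B}F-\Delta(F)$. (b) If $F\subseteq\mathbb{R}^n$ is Borel then, for almost all $V\in G(n,m)$, $$\dim_{\mathrm P}\pi_V F\ \geq\ \dim_{\mathrm P}F-\Delta(F).$$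
   Context: All sets $F$ are non-empty. $G(n,m)$ is the Grassmannian of $m$-dimensional linear subspaces of $\mathbb{R}^n$, "almost all" refers to its natural invariant (rotation-invariant) measure, and $\pi_V:\mathbb{R}^n\to V$ is orthogonal projection onto $V$. For non-empty bounded $E\subseteq\mathbb{R}^n$ and $r>0$, $N_r(E)$ is the minimum number of sets of diameter $r$ (using diameter at most $r$ gives the same dimensions) that can cover $E$. The lower and upper box dimensions are $\underline{\dim}_{\mathrm B}E=\liminf_{r\to0}\frac{\log N_r(E)}{-\log r}$ and $\overline{\dim}_{\mathrm B}E=\limsup_{r\to0}\frac{\log N_r(E)}{-\log r}$. The packing dimension of a (not necessarily bounded) set $F$ is $\dim_{\mathrm P}F=\inf\{\sup_j\overline{\dim}_{\mathrm B}F_j: F\subseteq\bigcup_{j=1}^\infty F_j,\ F_j\text{ compact}\}$. The Assouad dimension $\dim_{\mathrm A}F$ is the infimum of $\alpha$ for which there is a constant $C>0$ such that $N_r(B(x,R)\cap F)\leq C(R/r)^\alpha$ for all $0<r<R$ and $x\in F$. For $\theta\in(0,1)$ the upper Assouad spectrum $\overline{\dim}_{\mathrm A}^{\theta}F$ is the infimum of $\alpha$ for which there is a constant $C>0$ such that $N_r(B(x,R)\cap F)\leq C(R/r)^\alpha$ for all $0<r\leq R^{1/\theta}<R<1$ and $x\in F$. *)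

theory Defs
  imports "HOL-Probability.Probability"
begin

section \<open>Covering numbers and dimensions\<close>

text \<open>
  The conjunct \<open>bounded U\<close> is needed because \<^const>\<open>diameter\<close> is real-valued and has no
  meaningful value on unbounded sets. The lemma \<open>covering_number_eq_le\<close> below shows that
  asking for diameter at most \<open>r\<close> gives the same number.
\<close>

definition covering_number :: "real \<Rightarrow> 'a::euclidean_space set \<Rightarrow> nat" where
  "covering_number r E =
     (LEAST k. \<exists>\<U>. finite \<U> \<and> card \<U> = k \<and> (\<forall>U\<in>\<U>. bounded U \<and> diameter U = r) \<and> E \<subseteq> \<Union>\<U>)"

definition lower_box_dim :: "'a::euclidean_space set \<Rightarrow> ereal" where
  "lower_box_dim E = Liminf (at_right 0) (\<lambda>r. ereal (ln (real (covering_number r E)) / - ln r))"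

definition upper_box_dim :: "'a::euclidean_space set \<Rightarrow> ereal" where
  "upper_box_dim E = Limsup (at_right 0) (\<lambda>r. ereal (ln (real (covering_number r E)) / - ln r))"

definition packing_dim :: "'a::euclidean_space set \<Rightarrow> ereal" where
  "packing_dim F =
     Inf {(SUP j. upper_box_dim (K j)) | K :: nat \<Rightarrow> 'a set.
            (\<forall>j. compact (K j) \<and> K j \<noteq> {}) \<and> F \<subseteq> (\<Union>j. K j)}"

text \<open>
  In the two definitions below \<open>B(x, R)\<close> is the closed ball; open balls give the same values.
  All dimensions are \<^typ>\<open>ereal\<close>-valued, so that infima and limits of arbitrary families are
  meaningful; on non-empty subsets of a Euclidean space (bounded ones for the box dimensions) the
  values lie between 0 and the dimension of the space.
\<close>

definition assouad_dim :: "'a::euclidean_space set \<Rightarrow> ereal" where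
  "assouad_dim F =
     (INF \<alpha>\<in>{\<alpha>::real. \<exists>C>0. \<forall>r R. \<forall>x\<in>F. 0 < r \<and> r < R \<longrightarrow>
               real (covering_number r (cball x R \<inter> F)) \<le> C * (R / r) powr \<alpha>}. ereal \<alpha>)"

definition upper_assouad_spectrum :: "real \<Rightarrow> 'a::euclidean_space set \<Rightarrow> ereal" where
  "upper_assouad_spectrum \<theta> F =
     (INF \<alpha>\<in>{\<alpha>::real. \<exists>C>0. \<forall>r R. \<forall>x\<in>F.
               0 < r \<and> r \<le> R powr (1 / \<theta>) \<and> R powr (1 / \<theta>) < R \<and> R < 1 \<longrightarrow>
               real (covering_number r (cball x R \<inter> F)) \<le> C * (R / r) powr \<alpha>}. ereal \<alpha>)"

definition Delta :: "nat \<Rightarrow> real \<Rightarrow> 'a::euclidean_space set \<Rightarrow> ereal" where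
  "Delta m \<theta> F =
     max 0 (max (upper_assouad_spectrum \<theta> F - ereal (real m))
                ((assouad_dim F - ereal (real m)) * ereal (1 - \<theta>)))"


section \<open>The Grassmannian and its invariant measure\<close>

definition orth_proj :: "'a::euclidean_space set \<Rightarrow> 'a \<Rightarrow> 'a" where
  "orth_proj V x = (THE y. y \<in> V \<and> x - y \<in> V\<^sup>\<bottom>)"

definition grassmannian :: "nat \<Rightarrow> (real^'n) set set" where
  "grassmannian m = {V. subspace V \<and> dim V = m}"

text \<open>
  The topology of the Grassmannian is the one making \<open>V \<mapsto> \<pi>\<^sub>V\<close> an embedding into the space of
  matrices; its Borel sets are therefore the preimages of Borel sets of matrices.
\<close>

definition grassmann_borel :: "nat \<Rightarrow> (real^'n) set measure" where
  "grassmann_borel m = vimage_algebra (grassmannian m) (\<lambda>V. matrix (orth_proj V)) borel"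

text \<open>
  For \<open>m \<le> n\<close> exactly one measure satisfies this predicate: uniqueness is classical, and
  existence is the lemma \<open>invariant_grassmann_measure_exists\<close> at the end of this theory.
\<close>

definition invariant_grassmann_measure :: "nat \<Rightarrow> (real^'n) set measure \<Rightarrow> bool" where
  "invariant_grassmann_measure m \<gamma> \<longleftrightarrow>
     prob_space \<gamma> \<and> sets \<gamma> = sets (grassmann_borel m) \<and>
     (\<forall>g. orthogonal_transformation g \<longrightarrow> distr \<gamma> \<gamma> (\<lambda>V. g ` V) = \<gamma>)"


section \<open>Sanity lemmas for covering numbers\<close>

lemma enlarge_to_diameter:
  fixes U :: "'a::euclidean_space set"
  assumes "bounded U" "diameter U \<le> r" "0 < r"
  obtains U' where "U \<subseteq> U'" "bounded U'" "diameter U' = r"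
proof (cases "U = {}")
  case True
  obtain b :: 'a where b: "b \<in> Basis" using nonempty_Basis by blast
  have "diameter {0, r *\<^sub>R b} = r"
  proof (rule antisym)
    show "diameter {0, r *\<^sub>R b} \<le> r"
      using b \<open>0 < r\<close> by (intro diameter_le) (auto simp: norm_minus_commute)
    have "dist 0 (r *\<^sub>R b) \<le> diameter {0, r *\<^sub>R b}"
      by (intro diameter_bounded_bound) auto
    then show "r \<le> diameter {0, r *\<^sub>R b}" using b \<open>0 < r\<close> by (simp add: dist_norm)
  qed
  then show ?thesis using that[of "{0, r *\<^sub>R b}"] True by auto
next
  case False
  then obtain x where x: "x \<in> U" by auto
  obtain b :: 'a where b: "b \<in> Basis" using nonempty_Basis by blast
  define f where "f t = (SUP y\<in>U. dist y (x + t *\<^sub>R b))" for t :: real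
  have bdd: "bdd_above ((\<lambda>y. dist y z) ` U)" for z
  proof -
    obtain e where "\<forall>y\<in>U. dist z y \<le> e" using \<open>bounded U\<close> bounded_any_center by metis
    then show ?thesis by (intro bdd_aboveI2[of _ _ e]) (auto simp: dist_commute)
  qed
  have lip: "f s \<le> f t + dist s t" for s t
    unfolding f_def
  proof (rule cSUP_least[OF False])
    fix y assume y: "y \<in> U"
    have "dist y (x + s *\<^sub>R b) \<le> dist y (x + t *\<^sub>R b) + dist (x + t *\<^sub>R b) (x + s *\<^sub>R b)"
      by (rule dist_triangle)
    moreover have "dist (x + t *\<^sub>R b) (x + s *\<^sub>R b) = dist s t"
      using b by (simp add: dist_norm abs_minus_commute flip: scaleR_diff_left)
    moreover have "dist y (x + t *\<^sub>R b) \<le> (SUP y\<in>U. dist y (x + t *\<^sub>R b))"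
      using y bdd by (intro cSUP_upper)
    ultimately show "dist y (x + s *\<^sub>R b) \<le> (SUP y\<in>U. dist y (x + t *\<^sub>R b)) + dist s t"
      by linarith
  qed
  have "dist (f s) (f t) \<le> dist s t" for s t
    using lip[of s t] lip[of t s] by (simp add: dist_real_def abs_le_iff)
  then have cont: "continuous_on {0..r} f"
    by (metis (no_types, lifting) continuous_on_iff order_le_less_trans)
  have f0: "f 0 \<le> r"
    unfolding f_def
  proof (rule cSUP_least[OF False])
    fix y assume "y \<in> U"
    then have "dist y x \<le> diameter U" using x assms(1) by (intro diameter_bounded_bound)
    then show "dist y (x + 0 *\<^sub>R b) \<le> r" using assms(2) by simp
  qed
  have fr: "r \<le> f r"
  proof -
    have "dist x (x + r *\<^sub>R b) \<le> f r" unfolding f_def using x bdd by (intro cSUP_upper)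
    then show ?thesis using b \<open>0 < r\<close> by (simp add: dist_norm)
  qed
  obtain t where t: "0 \<le> t" "t \<le> r" "f t = r"
    using IVT'[of f 0 r r] f0 fr cont \<open>0 < r\<close> by auto
  define U' where "U' = insert (x + t *\<^sub>R b) U"
  have bd: "bounded U'" using assms(1) by (simp add: U'_def)
  have le: "dist y (x + t *\<^sub>R b) \<le> r" if "y \<in> U" for y
    using cSUP_upper[OF that bdd, of "x + t *\<^sub>R b"] t(3) by (simp add: f_def)
  have leU: "dist y z \<le> r" if "y \<in> U" "z \<in> U" for y z
    using diameter_bounded_bound[OF assms(1) that] assms(2) by linarith
  have "diameter U' \<le> r"
    using \<open>0 < r\<close> le leU
    by (intro diameter_le) (auto simp: U'_def dist_norm[symmetric] dist_commute)
  moreover have "r \<le> diameter U'"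
  proof -
    have "f t \<le> diameter U'"
      unfolding f_def
      by (intro cSUP_least[OF False] diameter_bounded_bound[OF bd]) (auto simp: U'_def)
    then show ?thesis using t by simp
  qed
  ultimately show ?thesis using that[of U'] bd by (auto simp: U'_def)
qed

lemma covering_number_eq_le:
  fixes E :: "'a::euclidean_space set"
  assumes "0 < r"
  shows "covering_number r E =
     (LEAST k. \<exists>\<U>. finite \<U> \<and> card \<U> = k \<and> (\<forall>U\<in>\<U>. bounded U \<and> diameter U \<le> r) \<and> E \<subseteq> \<Union>\<U>)"
proof -
  define P where "P k \<longleftrightarrow> (\<exists>\<U>. finite \<U> \<and> card \<U> = k \<and>
    (\<forall>U\<in>\<U>. bounded U \<and> diameter U = r) \<and> E \<subseteq> \<Union>\<U>)" for k
  define Q where "Q k \<longleftrightarrow> (\<exists>\<U>. finite \<U> \<and> card \<U> = k \<and>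
    (\<forall>U\<in>\<U>. bounded U \<and> diameter U \<le> r) \<and> E \<subseteq> \<Union>\<U>)" for k
  have PQ: "Q k" if "P k" for k
    using that unfolding P_def Q_def by (metis order_refl)
  have QP: "\<exists>j\<le>k. P j" if Q: "Q k" for k
  proof -
    obtain \<U> where U: "finite \<U>" "card \<U> = k" "\<forall>U\<in>\<U>. bounded U \<and> diameter U \<le> r" "E \<subseteq> \<Union>\<U>"
      using Q unfolding Q_def by blast
    have "\<forall>U\<in>\<U>. \<exists>U'. U \<subseteq> U' \<and> bounded U' \<and> diameter U' = r"
    proof
      fix U assume "U \<in> \<U>"
      then have "bounded U" "diameter U \<le> r" using U(3) by auto
      then show "\<exists>U'. U \<subseteq> U' \<and> bounded U' \<and> diameter U' = r"
        using enlarge_to_diameter[of U r] \<open>0 < r\<close> by metis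
    qed
    from bchoice[OF this] obtain h
      where h: "\<forall>U\<in>\<U>. U \<subseteq> h U \<and> bounded (h U) \<and> diameter (h U) = r" by (elim exE)
    have "\<Union>\<U> \<subseteq> \<Union>(h ` \<U>)" using h by (intro UN_mono[of \<U> \<U> "\<lambda>x. x" h, simplified]) auto
    then have "E \<subseteq> \<Union>(h ` \<U>)" using U(4) by (rule order_trans[rotated])
    then have "P (card (h ` \<U>))" unfolding P_def using h U(1) by (intro exI[of _ "h ` \<U>"]) auto
    moreover have "card (h ` \<U>) \<le> k" using U(1,2) card_image_le by blast
    ultimately show ?thesis by blast
  qed
  have "(LEAST k. P k) = (LEAST k. Q k)"
  proof (cases "\<exists>k. Q k")
    case True
    then have "Q (LEAST k. Q k)" by (rule LeastI_ex)
    then obtain j where j: "j \<le> (LEAST k. Q k)" "P j" using QP by blast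
    have "P (LEAST k. P k)" using j(2) by (rule LeastI)
    then have "(LEAST k. Q k) \<le> (LEAST k. P k)" by (intro Least_le PQ)
    moreover have "(LEAST k. P k) \<le> j" using j(2) by (rule Least_le)
    ultimately show ?thesis using j(1) by linarith
  next
    case False
    then have "P = Q" using PQ by blast
    then show ?thesis by simp
  qed
  then show ?thesis by (simp only: covering_number_def P_def Q_def)
qed

lemma covering_exists:
  fixes E :: "'a::euclidean_space set"
  assumes "bounded E" "0 < r"
  shows "\<exists>\<U>. finite \<U> \<and> (\<forall>U\<in>\<U>. bounded U \<and> diameter U \<le> r) \<and> E \<subseteq> \<Union>\<U>"
proof -
  have "compact (closure E)" using assms(1) by simp
  then obtain k where k: "finite k" "closure E \<subseteq> (\<Union>x\<in>k. ball x (r/2))"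
    using \<open>0 < r\<close> compact_eq_totally_bounded[of "closure E"] by (metis half_gt_zero)
  have "E \<subseteq> \<Union>((\<lambda>x. ball x (r/2)) ` k)" using k(2) closure_subset by blast
  then show ?thesis
    using k(1) \<open>0 < r\<close> by (intro exI[of _ "(\<lambda>x. ball x (r/2)) ` k"]) (auto simp: diameter_ball)
qed


section \<open>Orthogonal projections\<close>

lemma orth_proj_unique:
  assumes "subspace V" "y \<in> V" "x - y \<in> V\<^sup>\<bottom>"
  shows "orth_proj V x = y"
  unfolding orth_proj_def
proof (rule the_equality)
  show "y \<in> V \<and> x - y \<in> V\<^sup>\<bottom>" using assms by simp
  fix z assume z: "z \<in> V \<and> x - z \<in> V\<^sup>\<bottom>"
  have "z - y \<in> V" using z assms by (simp add: subspace_diff)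
  moreover have "(x - y) - (x - z) \<in> V\<^sup>\<bottom>"
    using z assms(3) subspace_diff[OF subspace_orthogonal_comp] by blast
  then have "z - y \<in> V\<^sup>\<bottom>" by simp
  ultimately have "z - y = 0" using orthogonal_Int_0[OF assms(1)] by blast
  then show "z = y" by simp
qed

lemma orth_proj:
  assumes "subspace V"
  shows "orth_proj V x \<in> V" "x - orth_proj V x \<in> V\<^sup>\<bottom>"
proof -
  obtain v w where vw: "x = v + w" "v \<in> V" "w \<in> V\<^sup>\<bottom>"
    using subspace_sum_orthogonal_comp[OF assms] set_plus_elim by (metis UNIV_I)
  then have "orth_proj V x = v" by (intro orth_proj_unique assms) auto
  then show "orth_proj V x \<in> V" "x - orth_proj V x \<in> V\<^sup>\<bottom>" using vw by auto
qed

lemma linear_orth_proj: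
  assumes "subspace V"
  shows "linear (orth_proj V)"
proof (rule linearI)
  note c = subspace_orthogonal_comp[of V]
  fix x y
  have "(x - orth_proj V x) + (y - orth_proj V y) \<in> V\<^sup>\<bottom>"
    using orth_proj[OF assms] subspace_add[OF c] by blast
  then show "orth_proj V (x + y) = orth_proj V x + orth_proj V y"
    by (intro orth_proj_unique assms subspace_add orth_proj) (simp add: algebra_simps)
next
  note c = subspace_orthogonal_comp[of V]
  fix a :: real and x
  have "a *\<^sub>R (x - orth_proj V x) \<in> V\<^sup>\<bottom>"
    using orth_proj[OF assms] subspace_scale[OF c] by blast
  then show "orth_proj V (a *\<^sub>R x) = a *\<^sub>R orth_proj V x"
    by (intro orth_proj_unique assms subspace_scale orth_proj) (simp add: algebra_simps)
qed

lemma orth_proj_image: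
  fixes g :: "'a::euclidean_space \<Rightarrow> 'a"
  assumes g: "orthogonal_transformation g" and V: "subspace V"
  shows "orth_proj (g ` V) (g x) = g (orth_proj V x)"
proof (rule orth_proj_unique)
  have lin: "linear g" using g by (simp add: orthogonal_transformation_linear)
  show "subspace (g ` V)" using lin V by (rule linear_subspace_image)
  show "g (orth_proj V x) \<in> g ` V" using orth_proj[OF V] by blast
  have "g y \<bullet> (g x - g (orth_proj V x)) = 0" if "y \<in> V" for y
  proof -
    have "g x - g (orth_proj V x) = g (x - orth_proj V x)" using lin by (simp add: linear_diff)
    then have "g y \<bullet> (g x - g (orth_proj V x)) = y \<bullet> (x - orth_proj V x)"
      using g by (simp add: orthogonal_transformation_def)
    also have "\<dots> = 0" using orth_proj(2)[OF V, of x] that by (auto simp: orthogonal_comp_def orthogonal_def)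
    finally show ?thesis .
  qed
  then show "g x - g (orth_proj V x) \<in> (g ` V)\<^sup>\<bottom>"
    by (auto simp: orthogonal_comp_def orthogonal_def)
qed


section \<open>Existence of the invariant measure\<close>

lemma emeasure_lborel_open_nonzero:
  fixes U :: "'a::euclidean_space set"
  assumes "open U" "U \<noteq> {}"
  shows "emeasure lborel U \<noteq> 0"
proof
  assume "emeasure lborel U = 0"
  then have "U \<in> null_sets lborel" using assms by auto
  then have "negligible U" by (simp add: negligible_iff_null_sets null_sets_completionI)
  then show False using assms open_not_negligible by blast
qed

lemma distr_lborel_orthogonal:
  fixes T :: "'a::euclidean_space \<Rightarrow> 'a"
  assumes T: "orthogonal_transformation T"
  shows "distr lborel borel T = lborel"
proof (rule measure_eqI)
  have lin: "linear T" using T by (simp add: orthogonal_transformation_linear)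
  have Tm[measurable]: "T \<in> borel_measurable borel"
    using lin by (intro borel_measurable_continuous_onI linear_continuous_on) (simp add: linear_conv_bounded_linear)
  obtain S where S: "T \<circ> S = id" "S \<circ> T = id" and "orthogonal_transformation S"
    using T orthogonal_transformation_inv[OF T] orthogonal_transformation_surj[OF T]
      orthogonal_transformation_inj[OF T]
    by (metis inj_iff surj_iff)
  have ST: "S (T x) = x" "T (S x) = x" for x using S by (metis comp_apply id_apply)+
  define \<mu> where "\<mu> = distr lborel borel T"
  have sm[measurable_cong]: "sets \<mu> = sets borel" by (simp add: \<mu>_def)
  have sm': "space \<mu> = UNIV" by (simp add: \<mu>_def)
  have tr: "distr \<mu> borel ((+) c) = \<mu>" for c
  proof -
    have "distr \<mu> borel ((+) c) = distr lborel borel (\<lambda>x. c + T x)"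
      unfolding \<mu>_def by (subst distr_distr) (auto simp: o_def)
    also have "(\<lambda>x. c + T x) = T \<circ> (\<lambda>x. S c + x)"
      using lin by (auto simp: linear_add ST)
    also have "distr lborel borel (T \<circ> (\<lambda>x. S c + x)) = distr (distr lborel borel ((+) (S c))) borel T"
      by (subst distr_distr) auto
    also have "\<dots> = \<mu>" by (simp add: lborel_distr_plus \<mu>_def)
    finally show ?thesis .
  qed
  have tr_nn: "(\<integral>\<^sup>+x. f x \<partial>\<mu>) = (\<integral>\<^sup>+x. f (c + x) \<partial>\<mu>)" if [measurable]: "f \<in> borel_measurable borel" for c f
  proof -
    have "(\<integral>\<^sup>+x. f x \<partial>\<mu>) = (\<integral>\<^sup>+x. f x \<partial>distr \<mu> borel ((+) c))" by (simp add: tr)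
    also have "\<dots> = (\<integral>\<^sup>+x. f (c + x) \<partial>\<mu>)" by (subst nn_integral_distr) auto
    finally show ?thesis .
  qed
  have trl_nn: "(\<integral>\<^sup>+x. f x \<partial>lborel) = (\<integral>\<^sup>+x. f (c + x) \<partial>lborel)"
    if [measurable]: "f \<in> borel_measurable borel" for c and f :: "'a \<Rightarrow> ennreal"
  proof -
    have "(\<integral>\<^sup>+x. f x \<partial>lborel) = (\<integral>\<^sup>+x. f x \<partial>distr lborel borel ((+) c))"
      by (simp add: lborel_distr_plus)
    also have "\<dots> = (\<integral>\<^sup>+x. f (c + x) \<partial>lborel)" by (subst nn_integral_distr) auto
    finally show ?thesis .
  qed
  define B where "B = ball (0::'a) 1"
  have Bm[measurable]: "B \<in> sets borel" by (simp add: B_def)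
  have norm_T: "norm (T x) = norm x" for x using T by (simp add: orthogonal_transformation_norm)
  have ball_eq: "emeasure \<mu> (ball 0 s) = emeasure lborel (ball (0::'a) s)" for s
  proof -
    have "T -` ball 0 s = ball (0::'a) s" using norm_T by auto
    then show ?thesis unfolding \<mu>_def by (subst emeasure_distr) auto
  qed
  interpret M: sigma_finite_measure \<mu>
  proof (standard, intro exI[of _ "range (\<lambda>n::nat. ball 0 (real n))"] conjI ballI)
    show "\<Union>(range (\<lambda>n::nat. ball (0::'a) (real n))) = space \<mu>"
      using sm' by (auto simp: reals_Archimedean2)
    fix a assume "a \<in> range (\<lambda>n::nat. ball (0::'a) (real n))"
    then show "emeasure \<mu> a \<noteq> \<infinity>" using emeasure_bounded_finite[OF bounded_ball, of "0::'a"] by (auto simp: ball_eq less_top[symmetric])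
  qed auto
  interpret P: pair_sigma_finite \<mu> lborel ..
  fix A assume "A \<in> sets (distr lborel borel T)"
  then have A[measurable]: "A \<in> sets borel" by simp
  have "emeasure \<mu> A * emeasure lborel B = (\<integral>\<^sup>+x. indicator A x * (\<integral>\<^sup>+y. indicator B y \<partial>lborel) \<partial>\<mu>)"
    by (simp add: nn_integral_multc)
  also have "\<dots> = (\<integral>\<^sup>+x. indicator A x * (\<integral>\<^sup>+y. indicator B (- x + y) \<partial>lborel) \<partial>\<mu>)"
    by (intro nn_integral_cong arg_cong2[of _ _ _ _ "(*)"] refl trl_nn) auto
  also have "\<dots> = (\<integral>\<^sup>+x. (\<integral>\<^sup>+y. indicator A x * indicator B (- x + y) \<partial>lborel) \<partial>\<mu>)"
    by (simp add: nn_integral_cmult)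
  also have "\<dots> = (\<integral>\<^sup>+y. (\<integral>\<^sup>+x. indicator A x * indicator B (- x + y) \<partial>\<mu>) \<partial>lborel)"
    by (rule P.Fubini'[symmetric]) measurable
  also have "\<dots> = (\<integral>\<^sup>+y. (\<integral>\<^sup>+x. indicator A (y + x) * indicator B (- x) \<partial>\<mu>) \<partial>lborel)"
  proof (rule nn_integral_cong)
    fix y :: 'a
    show "(\<integral>\<^sup>+x. indicator A x * indicator B (- x + y) \<partial>\<mu>) = (\<integral>\<^sup>+x. indicator A (y + x) * indicator B (- x) \<partial>\<mu>)"
      by (subst tr_nn[where c = y]) (auto simp: algebra_simps)
  qed
  also have "\<dots> = (\<integral>\<^sup>+x. (\<integral>\<^sup>+y. indicator A (y + x) * indicator B (- x) \<partial>lborel) \<partial>\<mu>)"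
    by (rule P.Fubini') measurable
  also have "\<dots> = (\<integral>\<^sup>+x. (\<integral>\<^sup>+y. indicator A (x + y) \<partial>lborel) * indicator B x \<partial>\<mu>)"
    by (simp add: nn_integral_multc add.commute B_def indicator_def)
  also have "\<dots> = (\<integral>\<^sup>+x. (\<integral>\<^sup>+y. indicator A y \<partial>lborel) * indicator B x \<partial>\<mu>)"
    by (intro nn_integral_cong arg_cong2[of _ _ _ _ "(*)"] refl trl_nn[symmetric]) auto
  also have "\<dots> = emeasure lborel A * emeasure lborel B"
    using ball_eq[of 1] by (subst nn_integral_cmult) (auto simp: B_def sm intro!: borel_measurable_indicator)
  finally have *: "emeasure \<mu> A * emeasure lborel B = emeasure lborel A * emeasure lborel B" .
  have "emeasure lborel B \<noteq> \<infinity>" using emeasure_lborel_ball_finite[of "0::'a" 1] by (auto simp: B_def)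
  moreover have "emeasure lborel B \<noteq> 0"
    using emeasure_lborel_open_nonzero[of B] by (auto simp: B_def)
  ultimately have "emeasure \<mu> A = emeasure lborel A"
    using * by (metis ennreal_mult_divide_eq infinity_ennreal_def)
  then show "emeasure (distr lborel borel T) A = emeasure lborel A" by (simp add: \<mu>_def)
qed auto

lemma measurable_grassmannian_image:
  fixes g :: "real^'n \<Rightarrow> real^'n"
  assumes g: "orthogonal_transformation g"
  shows "(\<lambda>V. g ` V) \<in> measurable (grassmann_borel m) (grassmann_borel m)"
proof -
  have lin: "linear g" using g by (simp add: orthogonal_transformation_linear)
  obtain h where h: "orthogonal_transformation h" "\<And>x. g (h x) = x"
    using orthogonal_transformation_inv[OF g] orthogonal_transformation_surj[OF g]
    by (metis surj_f_inv_f)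
  have linh: "linear h" using h by (simp add: orthogonal_transformation_linear)
  have space: "space (grassmann_borel m) = (grassmannian m :: (real^'n) set set)"
    by (simp add: grassmann_borel_def)
  have into: "g ` V \<in> grassmannian m" if "V \<in> grassmannian m" for V
    using that lin orthogonal_transformation_inj[OF g]
    by (auto simp: grassmannian_def linear_subspace_image dim_image_eq inj_on_subset)
  have eq: "matrix (orth_proj (g ` V)) = matrix g ** matrix (orth_proj V) ** matrix h"
    if "V \<in> grassmannian m" for V
  proof -
    have V: "subspace V" using that by (simp add: grassmannian_def)
    have "orth_proj (g ` V) x = g (orth_proj V (h x))" for x
      using orth_proj_image[OF g V, of "h x"] h by simp
    then have "orth_proj (g ` V) = (g \<circ> orth_proj V) \<circ> h" by auto
    then show ?thesis
      by (simp only: matrix_compose linh lin linear_orth_proj[OF V] linear_compose)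
  qed
  have P[measurable]: "(\<lambda>V. matrix (orth_proj V)) \<in> borel_measurable (grassmann_borel m)"
    unfolding grassmann_borel_def by (rule measurable_vimage_algebra1) auto
  have c: "continuous_on UNIV (\<lambda>A::real^'n^'n. matrix g ** A ** matrix h)"
    by (simp add: matrix_matrix_mult_def) (intro continuous_intros)
  have "(\<lambda>V. matrix g ** matrix (orth_proj V) ** matrix h) \<in> borel_measurable (grassmann_borel m)"
    by (rule measurable_compose[OF P borel_measurable_continuous_onI[OF c]])
  then have m: "(\<lambda>V. matrix (orth_proj (g ` V))) \<in> borel_measurable (grassmann_borel m)"
    by (subst measurable_cong[OF eq]) (simp_all add: space)
  have "(\<lambda>V. g ` V) \<in> measurable (grassmann_borel m)
          (vimage_algebra (grassmannian m) (\<lambda>V. matrix (orth_proj V)) borel)"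
    by (rule measurable_vimage_algebra2) (use m into space in auto)
  then show ?thesis by (subst (2) grassmann_borel_def)
qed

lemma continuous_on_det:
  fixes f :: "'a::topological_space \<Rightarrow> real^'n^'n"
  assumes "\<And>i j. continuous_on S (\<lambda>x. f x $ i $ j)"
  shows "continuous_on S (\<lambda>x. det (f x))"
  unfolding det_def by (intro continuous_intros assms)

text \<open>
  A random subspace is obtained as the row combinations \<open>x v* A\<close>, \<open>x\<close> in a fixed coordinate
  subspace, of a uniformly distributed invertible matrix \<open>A\<close> in the unit ball.
\<close>

lemma invariant_grassmann_measure_exists:
  assumes "m \<le> CARD('n::finite)"
  shows "\<exists>\<gamma> :: (real^'n) set measure. invariant_grassmann_measure m \<gamma>"
proof -
  obtain S :: "'n set" where S: "card S = m" using assms by (metis obtain_subset_with_card_n)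
  define W where "W = {x::real^'n. \<forall>i. i \<notin> S \<longrightarrow> x $ i = 0}"
  have W: "subspace W" "dim W = m"
  proof -
    let ?d = "(\<lambda>i. axis i 1 :: real^'n) ` S"
    have W_eq: "W = {x. \<forall>i\<in>Basis. i \<notin> ?d \<longrightarrow> x \<bullet> i = 0}"
      by (auto simp: W_def Basis_vec_def inner_axis axis_eq_axis image_iff)
    have "?d \<subseteq> Basis" by (auto simp: Basis_vec_def)
    moreover have "card ?d = m" using S by (subst card_image) (auto simp: inj_on_def axis_eq_axis)
    ultimately show "subspace W" "dim W = m"
      using subspace_substandard[of "\<lambda>i. i \<notin> ?d"] dim_substandard[of ?d] by (simp_all only: W_eq)
  qed
  define D where "D = {A::real^'n^'n. det A \<noteq> 0}"
  define \<Phi> where "\<Phi> A = (if A \<in> D then (\<lambda>x. x v* A) ` W else W)" for A :: "real^'n^'n"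
  have inv: "inj (\<lambda>x. x v* A)" if "A \<in> D" for A :: "real^'n^'n"
  proof -
    have "invertible (transpose A)" using that by (simp add: D_def invertible_det_nz)
    then have "inj ((*v) (transpose A))"
      by (simp add: invertible_eq_bij bij_is_inj)
    then show ?thesis by (simp add: inj_def transpose_matrix_vector)
  qed
  have linA: "linear (\<lambda>x. x v* A)" for A :: "real^'n^'n"
    by (metis (no_types, lifting) ext matrix_vector_mul_linear transpose_matrix_vector)
  have \<Phi>: "\<Phi> A \<in> grassmannian m" for A
    using W inv[of A] linA[of A]
    by (auto simp: \<Phi>_def grassmannian_def linear_subspace_image dim_image_eq inj_on_subset)
  have openD: "open D"
  proof -
    have "continuous_on UNIV (det :: real^'n^'n \<Rightarrow> real)"
      by (rule continuous_on_det) (intro continuous_intros)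
    then have "open (det -` (- {0}) :: (real^'n^'n) set)"
      by (intro open_vimage) auto
    then show ?thesis by (simp add: D_def vimage_def)
  qed

  define G where "G A = (\<chi> i j. if i \<in> S \<and> j \<in> S then A $ i \<bullet> A $ j
                              else if i = j then 1 else 0)" for A :: "real^'n^'n"
  define b where "b A y = (\<chi> i. if i \<in> S then A $ i \<bullet> y else 0)" for A :: "real^'n^'n" and y
  define z where "z A y = (\<chi> k. det (\<chi> i j. if j = k then b A y $ i else G A $ i $ j) / det (G A))"
    for A :: "real^'n^'n" and y
  have G_mult: "(G A *v x) $ i = (if i \<in> S then \<Sum>j\<in>S. (A $ i \<bullet> A $ j) * x $ j else x $ i)" for A x i
  proof -
    have "(G A *v x) $ i = (\<Sum>j\<in>UNIV. (if i \<in> S \<and> j \<in> S then A $ i \<bullet> A $ j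
                              else if i = j then 1 else 0) * x $ j)"
      by (simp add: matrix_vector_mult_def G_def)
    also have "\<dots> = (if i \<in> S then \<Sum>j\<in>S. (A $ i \<bullet> A $ j) * x $ j else x $ i)"
    proof (cases "i \<in> S")
      case True
      have "(\<Sum>j\<in>UNIV. (if i \<in> S \<and> j \<in> S then A $ i \<bullet> A $ j else if i = j then 1 else 0) * x $ j)
          = (\<Sum>j\<in>UNIV. if j \<in> S then (A $ i \<bullet> A $ j) * x $ j else 0)"
        using True by (intro sum.cong) auto
      then show ?thesis using True by (simp flip: sum.inter_restrict)
    next
      case False
      then show ?thesis by (simp add: if_distrib[of "\<lambda>c. c * _"] cong: if_cong)
    qed
    finally show ?thesis .
  qed
  have vA: "x v* A = (\<Sum>j\<in>S. x $ j *\<^sub>R A $ j)" if "x \<in> W" for x and A :: "real^'n^'n"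
  proof -
    have "x v* A = (\<Sum>j\<in>UNIV. x $ j *\<^sub>R A $ j)"
      by (simp add: vector_matrix_mult_def vec_eq_iff mult.commute)
    also have "\<dots> = (\<Sum>j\<in>S. x $ j *\<^sub>R A $ j)"
      using that by (intro sum.mono_neutral_right) (auto simp: W_def)
    finally show ?thesis .
  qed
  have detG: "det (G A) \<noteq> 0" if A: "A \<in> D" for A
  proof -
    have "x = 0" if x: "G A *v x = 0" for x
    proof -
      have xW: "x \<in> W"
        unfolding W_def
      proof (safe)
        fix i assume "i \<notin> S"
        then show "x $ i = 0" using G_mult[of A x i] x by simp
      qed
      have "(x v* A) \<bullet> (x v* A) = (\<Sum>i\<in>S. x $ i * (\<Sum>j\<in>S. (A $ i \<bullet> A $ j) * x $ j))"
        by (simp add: vA[OF xW] inner_sum_left inner_sum_right sum_distrib_left ac_simps)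
          (simp add: inner_commute)
      also have "\<dots> = (\<Sum>i\<in>S. x $ i * (G A *v x) $ i)" by (simp add: G_mult)
      also have "\<dots> = 0" using x by simp
      finally have "x v* A = 0 v* A" by simp
      then show "x = 0" using inv[OF A] by (metis injD)
    qed
    then show ?thesis
      using invertible_det_nz[of "G A"] matrix_left_invertible_ker invertible_left_inverse by metis
  qed
  have zsol: "G A *v z A y = b A y" if "A \<in> D" for A y
    using cramer[OF detG[OF that], of "z A y" "b A y"] unfolding z_def by simp
  have zW: "z A y \<in> W" if "A \<in> D" for A y
    unfolding W_def
  proof (safe)
    fix i assume "i \<notin> S"
    then show "z A y $ i = 0" using zsol[OF that, of y] G_mult[of A "z A y" i] by (simp add: b_def)
  qed
  have proj: "orth_proj (\<Phi> A) y = (\<Sum>j\<in>S. z A y $ j *\<^sub>R A $ j)" if A: "A \<in> D" for A y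
  proof (rule orth_proj_unique)
    show "subspace (\<Phi> A)" using \<Phi>[of A] by (simp add: grassmannian_def)
    show "(\<Sum>j\<in>S. z A y $ j *\<^sub>R A $ j) \<in> \<Phi> A"
      using A zW[OF A, of y] vA[OF zW[OF A, of y], of A] by (auto simp: \<Phi>_def intro!: image_eqI[of _ _ "z A y"])
    have "A $ i \<bullet> (y - (\<Sum>j\<in>S. z A y $ j *\<^sub>R A $ j)) = 0" if i: "i \<in> S" for i
    proof -
      have "A $ i \<bullet> y = (G A *v z A y) $ i" using zsol[OF A, of y] i by (simp add: b_def)
      also have "\<dots> = (\<Sum>j\<in>S. (A $ i \<bullet> A $ j) * z A y $ j)" using i by (simp add: G_mult)
      finally show ?thesis by (simp add: inner_diff_right inner_sum_right ac_simps)
    qed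
    then have "(x v* A) \<bullet> (y - (\<Sum>j\<in>S. z A y $ j *\<^sub>R A $ j)) = 0" if "x \<in> W" for x
      by (simp add: vA[OF that] inner_sum_left)
    then show "y - (\<Sum>j\<in>S. z A y $ j *\<^sub>R A $ j) \<in> (\<Phi> A)\<^sup>\<bottom>"
      using A by (auto simp: \<Phi>_def orthogonal_comp_def orthogonal_def)
  qed
  have cont: "continuous_on D (\<lambda>A. matrix (orth_proj (\<Phi> A)))"
  proof -
    have G: "continuous_on D (\<lambda>A. G A $ i $ j)" for i j
      by (cases "i \<in> S \<and> j \<in> S"; cases "i = j") (auto simp: G_def intro!: continuous_intros)
    have b: "continuous_on D (\<lambda>A. b A y $ i)" for i y
      by (cases "i \<in> S") (auto simp: b_def intro!: continuous_intros)
    have z: "continuous_on D (\<lambda>A. z A y $ k)" for k y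
    proof -
      have "continuous_on D (\<lambda>A. (\<chi> i j. if j = k then b A y $ i else G A $ i $ j) $ i $ j)" for i j
        by (cases "j = k") (auto simp: G b)
      then show ?thesis
        unfolding z_def vec_lambda_beta using detG
        by (intro continuous_on_divide continuous_on_det G) auto
    qed
    have *: "continuous_on D (\<lambda>A. \<Sum>k\<in>S. z A y $ k *\<^sub>R A $ k)" for y
      by (intro continuous_intros z)
    have "continuous_on D (\<lambda>A. orth_proj (\<Phi> A) y)" for y
      by (rule continuous_on_cong[THEN iffD1, OF refl _ *]) (simp add: proj)
    then show ?thesis
      unfolding matrix_def by (intro continuous_on_vec_lambda continuous_on_component)
  qed
  have \<Phi>_meas: "\<Phi> \<in> measurable borel (grassmann_borel m)"
  proof -
    have "(\<lambda>A. if A \<in> D then matrix (orth_proj (\<Phi> A)) else matrix (orth_proj W)) \<in> borel_measurable borel"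
      using openD cont by (intro borel_measurable_continuous_on_if) auto
    also have "(\<lambda>A. if A \<in> D then matrix (orth_proj (\<Phi> A)) else matrix (orth_proj W))
             = (\<lambda>A. matrix (orth_proj (\<Phi> A)))"
      by (auto simp: \<Phi>_def)
    finally show ?thesis
      unfolding grassmann_borel_def by (intro measurable_vimage_algebra2) (use \<Phi> in auto)
  qed

  define U where "U = D \<inter> ball 0 1"
  have openU: "open U" unfolding U_def using openD by auto
  have "U \<noteq> {}"
  proof -
    define c where "c = 1 / (norm (mat 1 :: real^'n^'n) + 1)"
    have c: "c > 0" unfolding c_def by (simp add: add_nonneg_pos)
    have "norm (c *\<^sub>R mat 1 :: real^'n^'n) < 1"
      by (simp add: c_def divide_simps add_nonneg_pos)
    moreover have "det (c *\<^sub>R mat 1 :: real^'n^'n) \<noteq> 0"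
    proof -
      have "det (c *\<^sub>R mat 1 :: real^'n^'n) = (\<Prod>i\<in>(UNIV::'n set). c)"
        by (subst det_diagonal) (auto simp: mat_def)
      then show ?thesis using c by simp
    qed
    ultimately have "c *\<^sub>R mat 1 \<in> U" by (simp add: U_def D_def)
    then show ?thesis by auto
  qed
  then have U0: "emeasure lborel U \<noteq> 0" using openU emeasure_lborel_open_nonzero by blast
  have Uinf: "emeasure lborel U \<noteq> \<infinity>"
    using emeasure_bounded_finite[of U] by (simp add: U_def bounded_Int less_top)
  define P where "P = uniform_measure lborel U"
  interpret P: prob_space P unfolding P_def by (rule prob_space_uniform_measure[OF U0 Uinf])
  have sP[measurable_cong]: "sets P = sets borel" by (simp add: P_def)
  define \<gamma> where "\<gamma> = distr P (grassmann_borel m) \<Phi>"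
  have \<Phi>P: "\<Phi> \<in> measurable P (grassmann_borel m)"
    using \<Phi>_meas by (simp add: measurable_cong_sets[OF sP refl])
  have inv\<gamma>: "distr \<gamma> \<gamma> (\<lambda>V. g ` V) = \<gamma>" if g: "orthogonal_transformation g" for g
  proof -
    have ling: "linear g" using g by (simp add: orthogonal_transformation_linear)
    define T where "T A = (\<chi> i. g (A $ i))" for A :: "real^'n^'n"
    have T: "orthogonal_transformation T"
    proof -
      have "linear T"
        using ling by (intro linearI) (auto simp: T_def vec_eq_iff linear_add linear_scale)
      moreover have "T A \<bullet> T B = A \<bullet> B" for A B
        using g by (simp add: T_def inner_vec_def orthogonal_transformation_def)
      ultimately show ?thesis by (simp add: orthogonal_transformation_def)
    qed
    have Tm[measurable]: "T \<in> borel_measurable borel"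
      using T by (intro borel_measurable_continuous_onI linear_continuous_on)
        (simp add: orthogonal_transformation_linear flip: linear_conv_bounded_linear)
    have Tx: "x v* T A = g (x v* A)" for x A
    proof -
      have "x v* A = (\<Sum>j\<in>UNIV. x $ j *\<^sub>R A $ j)" for A :: "real^'n^'n"
        by (simp add: vector_matrix_mult_def vec_eq_iff mult.commute)
      then show ?thesis using ling by (simp add: T_def linear_sum linear_scale)
    qed
    have TA: "T A = A ** transpose (matrix g)" for A
    proof -
      have "g y = matrix g *v y" for y using ling by simp
      then have "g y $ j = (\<Sum>k\<in>UNIV. y $ k * matrix g $ j $ k)" for y j
        by (metis (no_types, lifting) matrix_vector_mult_def mult.commute sum.cong vec_lambda_beta)
      then show ?thesis
        by (simp add: T_def matrix_matrix_mult_def transpose_def vec_eq_iff)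
    qed
    have "det (matrix g) \<noteq> 0"
      using orthogonal_transformation_det[OF g] by auto
    then have TD: "T A \<in> D \<longleftrightarrow> A \<in> D" for A
      by (simp add: D_def TA det_mul)
    have TU: "T -` U = U"
      using TD orthogonal_transformation_norm[OF T] by (auto simp: U_def)
    have PT: "distr P borel T = P"
    proof (rule measure_eqI)
      fix X assume "X \<in> sets (distr P borel T)"
      then have [measurable]: "X \<in> sets borel" by simp
      have [measurable]: "U \<in> sets borel" using openU by simp
      have "emeasure (distr P borel T) X = emeasure P (T -` X)"
        by (subst emeasure_distr) (auto simp: P_def)
      also have "\<dots> = emeasure lborel (U \<inter> T -` X) / emeasure lborel U"
        unfolding P_def using measurable_sets_borel[OF Tm] by (intro emeasure_uniform_measure) auto
      also have "U \<inter> T -` X = T -` (U \<inter> X)" using TU by auto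
      also have "emeasure lborel (T -` (U \<inter> X)) = emeasure (distr lborel borel T) (U \<inter> X)"
        by (subst emeasure_distr) auto
      also have "\<dots> = emeasure lborel (U \<inter> X)" by (simp add: distr_lborel_orthogonal[OF T])
      also have "\<dots> / emeasure lborel U = emeasure P X"
        unfolding P_def by (intro emeasure_uniform_measure[symmetric]) auto
      finally show "emeasure (distr P borel T) X = emeasure P X" .
    qed (simp add: sP)
    have g\<Phi>: "g ` \<Phi> A = \<Phi> (T A)" if "A \<in> D" for A
      using that by (simp add: \<Phi>_def TD image_image Tx)
    have AED: "AE A in P. A \<in> D"
      unfolding P_def using openU by (intro AE_uniform_measureI) (auto simp: U_def)
    have gm: "(\<lambda>V. g ` V) \<in> measurable (grassmann_borel m) (grassmann_borel m)"
      by (rule measurable_grassmannian_image[OF g])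
    have "distr \<gamma> \<gamma> (\<lambda>V. g ` V) = distr \<gamma> (grassmann_borel m) (\<lambda>V. g ` V)"
      by (intro distr_cong) (auto simp: \<gamma>_def)
    also have "\<dots> = distr P (grassmann_borel m) ((\<lambda>V. g ` V) \<circ> \<Phi>)"
      unfolding \<gamma>_def by (rule distr_distr[OF gm \<Phi>P])
    also have "\<dots> = distr P (grassmann_borel m) (\<Phi> \<circ> T)"
    proof (rule distr_cong_AE)
      show "AE A in P. ((\<lambda>V. g ` V) \<circ> \<Phi>) A = (\<Phi> \<circ> T) A"
        using AED by eventually_elim (simp add: g\<Phi>)
      show "(\<lambda>V. g ` V) \<circ> \<Phi> \<in> measurable P (grassmann_borel m)"
        using \<Phi>P gm by (rule measurable_comp)
      show "\<Phi> \<circ> T \<in> measurable P (grassmann_borel m)"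
        by (rule measurable_comp[OF _ \<Phi>_meas]) (simp add: measurable_cong_sets[OF sP refl])
    qed auto
    also have "\<dots> = distr (distr P borel T) (grassmann_borel m) \<Phi>"
      by (rule distr_distr[symmetric, OF \<Phi>_meas]) (simp add: measurable_cong_sets[OF sP refl])
    also have "\<dots> = \<gamma>" by (simp add: PT \<gamma>_def)
    finally show ?thesis .
  qed
  have "prob_space \<gamma>" unfolding \<gamma>_def by (rule P.prob_space_distr[OF \<Phi>P])
  then have "invariant_grassmann_measure m \<gamma>"
    using inv\<gamma> by (simp add: invariant_grassmann_measure_def \<gamma>_def)
  then show ?thesis by blast
qed

end

theory Submission
  imports Defs
begin

text \<open>
  For \<open>\<sigma>\<close>-separated points of a bounded set \<open>F\<close>, summing over dyadic shells shows that the discrete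
  energy \<open>\<Sum>\<^sub>y (\<sigma> / |x - y|)\<^sup>m\<close> is at most \<open>log(1/\<sigma>) \<sigma>\<^bsup>-D\<^esup>\<close> up to a constant, for every \<open>D > \<Delta>(F)\<close>:
  shells of radius below \<open>\<sigma>\<^bsup>\<theta>\<^esup>\<close> are counted by the Assouad dimension, the larger ones by the Assouad
  spectrum. Since \<open>\<gamma>{V. |\<pi>\<^sub>V x| \<le> r}\<close> is of order at most \<open>(r / |x|)\<^sup>m\<close>, this bounds the expected number of
  pairs of points with close projections. Summing over dyadic scales, for almost every \<open>V\<close> there are
  few such pairs at all small scales, and by Cauchy-Schwarz \<open>N\<^sub>r(\<pi>\<^sub>V F) \<ge> c r\<^bsup>D\<^esup> N\<^sub>r(F)\<close>. This gives the bounds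
  for the box dimensions.

  For packing dimension, write a bounded Borel piece of \<open>F\<close> as the projection of a closed subset of
  the Polish space \<open>\<real>\<^sup>n \<times> \<real>\<^sup>\<nat>\<close>, and pass to a closed subset \<open>T\<close> all of whose relatively open pieces
  project to sets of packing dimension greater than \<open>s\<close>. Given a countable compact cover of \<open>\<pi>\<^sub>V F\<close>,
  Baire's theorem in \<open>T\<close> puts the projection of such a piece in a single member of the cover, to which
  the result for upper box dimension, applied to countably many pieces, is applicable.
\<close>

section \<open>Covering numbers and separated sets\<close>

lemma covering_number_le:
  fixes E :: "'a::euclidean_space set"
  assumes "0 < r" "finite \<U>" "\<And>U. U \<in> \<U> \<Longrightarrow> bounded U \<and> diameter U \<le> r" "E \<subseteq> \<Union>\<U>"
  shows "covering_number r E \<le> card \<U>"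
  unfolding covering_number_eq_le[OF assms(1)] using assms by (intro Least_le exI[of _ \<U>]) auto

lemma covering_number_obtains:
  fixes E :: "'a::euclidean_space set"
  assumes "bounded E" "0 < r"
  obtains \<U> where "finite \<U>" "card \<U> = covering_number r E"
    "\<And>U. U \<in> \<U> \<Longrightarrow> bounded U \<and> diameter U \<le> r" "E \<subseteq> \<Union>\<U>"
proof -
  obtain \<V> where \<V>: "finite \<V>" "\<forall>U\<in>\<V>. bounded U \<and> diameter U \<le> r" "E \<subseteq> \<Union>\<V>"
    using covering_exists[OF assms] by blast
  define Q where "Q k \<longleftrightarrow> (\<exists>\<U>. finite \<U> \<and> card \<U> = k \<and>
    (\<forall>U\<in>\<U>. bounded U \<and> diameter U \<le> r) \<and> E \<subseteq> \<Union>\<U>)" for k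
  have "Q (card \<V>)" unfolding Q_def using \<V> by blast
  then have "Q (LEAST k. Q k)" by (rule LeastI)
  then have "Q (covering_number r E)"
    by (simp add: covering_number_eq_le[OF assms(2)] Q_def)
  then show ?thesis using that unfolding Q_def by blast
qed

lemma covering_number_mono:
  fixes A B :: "'a::euclidean_space set"
  assumes "bounded B" "A \<subseteq> B" "0 < s" "s \<le> r"
  shows "covering_number r A \<le> covering_number s B"
proof -
  obtain \<U> where \<U>: "finite \<U>" "card \<U> = covering_number s B"
    "\<And>U. U \<in> \<U> \<Longrightarrow> bounded U \<and> diameter U \<le> s" "B \<subseteq> \<Union>\<U>"
    using covering_number_obtains[OF assms(1,3)] by metis
  have "covering_number r A \<le> card \<U>"
    using \<U> assms by (intro covering_number_le) (auto, meson order_trans)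
  then show ?thesis using \<U> by simp
qed

lemma covering_number_pos:
  fixes E :: "'a::euclidean_space set"
  assumes "bounded E" "E \<noteq> {}" "0 < r"
  shows "1 \<le> covering_number r E"
proof -
  obtain \<U> where "finite \<U>" "card \<U> = covering_number r E" "E \<subseteq> \<Union>\<U>"
    using covering_number_obtains[OF assms(1,3)] by metis
  then show ?thesis using assms(2)
    by (metis Sup_empty card_gt_0_iff le_eq_less_or_eq less_one not_le subset_empty)
qed

text \<open>Closing every set of a finite cover keeps its diameter, and the closed union then
  contains the closure. Passing to compact sets therefore costs nothing in the packing
  dimension.\<close>

lemma covering_number_closure_le:
  fixes E :: "'a::euclidean_space set"
  assumes "bounded E" "0 < r"
  shows "covering_number r (closure E) \<le> covering_number r E"
proof -
  obtain \<U> where \<U>: "finite \<U>" "card \<U> = covering_number r E"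
    "\<And>U. U \<in> \<U> \<Longrightarrow> bounded U \<and> diameter U \<le> r" "E \<subseteq> \<Union>\<U>"
    using covering_number_obtains[OF assms] by metis
  have "closure E \<subseteq> \<Union>(closure ` \<U>)"
    using \<U>(1,4) by (intro closure_minimal closed_UN) (auto intro: closure_subset[THEN subsetD])
  then have "covering_number r (closure E) \<le> card (closure ` \<U>)"
    using \<U> assms by (intro covering_number_le) (auto simp: diameter_closure)
  then show ?thesis using \<U>(1,2) card_image_le[of \<U> closure] by simp
qed

section \<open>Separated sets and volume counting\<close>

text \<open>With the strict inequality, a set of diameter at most \<open>r\<close> contains at most
  one point, so separated sets and covers compare at the same scale.\<close>

definition separated :: "real \<Rightarrow> 'a::metric_space set \<Rightarrow> bool" where
  "separated r P \<longleftrightarrow> (\<forall>x\<in>P. \<forall>y\<in>P. x \<noteq> y \<longrightarrow> r < dist x y)"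

lemma separated_subset: "separated r P \<Longrightarrow> Q \<subseteq> P \<Longrightarrow> separated r Q"
  by (auto simp: separated_def)

text \<open>Choosing for each point a covering set that contains it is injective: two points in one
  set would be within \<open>r\<close> of each other. Finiteness comes from the same
  injection.\<close>

lemma separated_card_le:
  fixes E :: "'a::euclidean_space set"
  assumes "bounded E" "0 < r" "P \<subseteq> E" "separated r P"
  shows "finite P \<and> card P \<le> covering_number r E"
proof -
  obtain \<U> where \<U>: "finite \<U>" "card \<U> = covering_number r E"
    "\<And>U. U \<in> \<U> \<Longrightarrow> bounded U \<and> diameter U \<le> r" "E \<subseteq> \<Union>\<U>"
    using covering_number_obtains[OF assms(1,2)] by metis
  have "\<forall>p\<in>P. \<exists>U\<in>\<U>. p \<in> U" using assms(3) \<U>(4) by blast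
  then obtain f where f: "\<And>p. p \<in> P \<Longrightarrow> f p \<in> \<U> \<and> p \<in> f p" by metis
  have "inj_on f P"
  proof (rule inj_onI, rule ccontr)
    fix x y assume xy: "x \<in> P" "y \<in> P" "f x = f y" "x \<noteq> y"
    then have "dist x y \<le> diameter (f x)"
      using f \<U>(3) by (intro diameter_bounded_bound) metis+
    then show False using assms(4) xy f[of x] \<U>(3)[of "f x"] by (force simp: separated_def)
  qed
  moreover have "f ` P \<subseteq> \<U>" using f by auto
  ultimately show ?thesis using \<U>(1,2) by (metis card_inj_on_le inj_on_finite)
qed

text \<open>Cardinalities of separated subsets are bounded by a covering number, so a largest one
  exists; a point farther than \<open>r\<close> from all of it could be added. The factor 2 is the
  diameter of a ball of radius \<open>r\<close>.\<close>

lemma maximal_separated_exists: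
  fixes E :: "'a::euclidean_space set"
  assumes "bounded E" "0 < r"
  obtains P where "P \<subseteq> E" "finite P" "separated r P" "E \<subseteq> (\<Union>p\<in>P. cball p r)"
    "covering_number (2 * r) E \<le> card P"
proof -
  define Q where "Q P \<longleftrightarrow> P \<subseteq> E \<and> separated r P" for P
  have "Q {}" by (simp add: Q_def separated_def)
  moreover have "\<forall>P. Q P \<longrightarrow> card P < Suc (covering_number r E)"
    using separated_card_le[OF assms] by (auto simp: Q_def less_Suc_eq_le)
  ultimately obtain P where P: "Q P" "\<And>P'. Q P' \<Longrightarrow> card P' \<le> card P"
    using ex_has_greatest_nat[of Q "{}" card] by blast
  have fin: "finite P" using P(1) separated_card_le[OF assms] by (auto simp: Q_def)
  have "\<exists>p\<in>P. x \<in> cball p r" if x: "x \<in> E" for x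
  proof (rule ccontr)
    assume *: "\<not> ?thesis"
    then have "x \<notin> P" using assms(2) by auto
    have "Q (insert x P)" using P(1) x * by (auto simp: Q_def separated_def dist_commute not_le)
    then show False using P(2)[of "insert x P"] \<open>x \<notin> P\<close> fin by simp
  qed
  then have cov: "E \<subseteq> (\<Union>p\<in>P. cball p r)" by blast
  then have "covering_number (2 * r) E \<le> card ((\<lambda>p. cball p r) ` P)"
    using fin assms(2) by (intro covering_number_le) (auto simp: diameter_cball)
  also have "\<dots> \<le> card P" using fin by (rule card_image_le)
  finally show ?thesis using that P(1) fin cov by (auto simp: Q_def)
qed

text \<open>Volume comparison: small balls around separated points are disjoint and lie in a
  slightly enlarged ball. This is what makes the Assouad dimension, and hence \<open>Delta\<close>,
  finite.\<close>

lemma covering_number_cball_le: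
  fixes F :: "'a::euclidean_space set"
  assumes "0 < r" "r < R"
  shows "real (covering_number r (cball x R \<inter> F)) \<le> (5 * R / r) ^ DIM('a)"
proof -
  define n where "n = DIM('a)"
  \<comment> \<open>Half the scale, because a maximal \<open>\<sigma>\<close>-separated set controls
    the covering number at \<open>2 * \<sigma>\<close>.\<close>
  define \<sigma> where "\<sigma> = r / 2"
  have \<sigma>: "0 < \<sigma>" "2 * \<sigma> = r" using assms by (auto simp: \<sigma>_def)
  have "bounded (cball x R \<inter> F)" by (simp add: bounded_Int)
  then obtain P where P: "P \<subseteq> cball x R \<inter> F" "finite P" "separated \<sigma> P"
    "covering_number (2 * \<sigma>) (cball x R \<inter> F) \<le> card P"
    using maximal_separated_exists[of "cball x R \<inter> F" \<sigma>] \<sigma>(1) by metis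
  define w where "w = measure lborel (ball (0::'a) 1)"
  have w: "w > 0" by (simp add: w_def content_ball_pos)
  have vol: "measure lborel (ball p t) = t ^ n * w" if "t \<ge> 0" for p :: 'a and t
    using content_ball_conv_unit_ball[OF that, of p] by (simp add: w_def n_def)
  have disj: "disjoint_family_on (\<lambda>p. ball p (\<sigma>/2)) P"
    unfolding disjoint_family_on_def
  proof (intro ballI impI, rule ccontr)
    fix p q assume pq: "p \<in> P" "q \<in> P" "p \<noteq> q" "ball p (\<sigma>/2) \<inter> ball q (\<sigma>/2) \<noteq> {}"
    then obtain z where "dist p z < \<sigma>/2" "dist q z < \<sigma>/2" by auto
    then have "dist p q < \<sigma>" using dist_triangle_half_r[of z] by (smt (verit) dist_commute dist_triangle field_sum_of_halves)
    then show False using P(3) pq by (force simp: separated_def)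
  qed
  have "real (card P) * ((\<sigma>/2) ^ n * w) = (\<Sum>p\<in>P. measure lborel (ball p (\<sigma>/2)))"
    using \<sigma> by (simp add: vol)
  also have "\<dots> = measure lborel (\<Union>p\<in>P. ball p (\<sigma>/2))"
    using P(2) disj
    by (intro measure_finite_Union[symmetric]) (use emeasure_bounded_finite[OF bounded_ball] in \<open>auto simp: less_top\<close>)
  also have "\<dots> \<le> measure lborel (ball x (R + \<sigma>/2))"
  proof (rule measure_mono_fmeasurable)
    show "(\<Union>p\<in>P. ball p (\<sigma>/2)) \<subseteq> ball x (R + \<sigma>/2)"
    proof (safe)
      fix p y assume p: "p \<in> P" "y \<in> ball p (\<sigma>/2)"
      then have "dist x p \<le> R" "dist p y < \<sigma>/2" using P(1) by auto
      then show "y \<in> ball x (R + \<sigma>/2)" using dist_triangle[of x y p] by simp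
    qed
  qed (use P(2) emeasure_bounded_finite[OF bounded_ball] in \<open>auto intro!: fmeasurableI\<close>)
  also have "\<dots> = (R + \<sigma>/2) ^ n * w" using assms \<sigma> by (simp add: vol)
  finally have "real (card P) * (\<sigma>/2) ^ n \<le> (R + \<sigma>/2) ^ n" using w by (simp add: mult.assoc[symmetric])
  then have "real (card P) \<le> ((R + \<sigma>/2) / (\<sigma>/2)) ^ n"
    using \<sigma>(1) by (subst power_divide, subst pos_le_divide_eq) auto
  also have "\<dots> \<le> (5 * R / r) ^ n"
    using assms by (intro power_mono) (auto simp: \<sigma>_def field_simps)
  finally show ?thesis using P(4) \<sigma>(2) by (simp add: n_def)
qed

section \<open>Bounds and monotonicity for the Assouad quantities and \<open>Delta\<close>\<close>

lemma assouad_dim_le_DIM: "assouad_dim (F :: 'a::euclidean_space set) \<le> ereal (real DIM('a))"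
  unfolding assouad_dim_def
proof (rule INF_lower, safe)
  have "real (covering_number r (cball x R \<inter> F)) \<le> 5 ^ DIM('a) * (R / r) powr real DIM('a)"
    if "0 < r" "r < R" for r R x
    using covering_number_cball_le[OF that, of x F] that
    by (simp add: powr_realpow power_mult_distrib power_divide)
  then show "\<exists>C>0. \<forall>r R. \<forall>x\<in>F. 0 < r \<and> r < R \<longrightarrow>
      real (covering_number r (cball x R \<inter> F)) \<le> C * (R / r) powr real DIM('a)"
    by (intro exI[of _ "5 ^ DIM('a)"]) auto
qed

text \<open>The spectrum tests fewer pairs of scales, so every exponent admissible for the Assouad
  dimension is admissible for it.\<close>

lemma upper_assouad_spectrum_le_assouad_dim:
  "upper_assouad_spectrum \<theta> F \<le> assouad_dim F"
  unfolding upper_assouad_spectrum_def assouad_dim_def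
proof (rule INF_superset_mono[OF _ order_refl], safe)
  fix \<alpha> C :: real assume C: "C > 0" "\<forall>r R. \<forall>x\<in>F. 0 < r \<and> r < R \<longrightarrow>
      real (covering_number r (cball x R \<inter> F)) \<le> C * (R / r) powr \<alpha>"
  show "\<exists>C>0. \<forall>r R. \<forall>x\<in>F.
      0 < r \<and> r \<le> R powr (1 / \<theta>) \<and> R powr (1 / \<theta>) < R \<and> R < 1 \<longrightarrow>
      real (covering_number r (cball x R \<inter> F)) \<le> C * (R / r) powr \<alpha>"
    by (intro exI[of _ C] conjI C(1)) (auto intro: C(2)[rule_format])
qed

lemma assouad_dim_mono:
  assumes "A \<subseteq> B"
  shows "assouad_dim A \<le> assouad_dim B"
  unfolding assouad_dim_def
proof (rule INF_superset_mono[OF _ order_refl], safe)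
  fix \<alpha> C :: real assume C: "C > 0" "\<forall>r R. \<forall>x\<in>B. 0 < r \<and> r < R \<longrightarrow>
      real (covering_number r (cball x R \<inter> B)) \<le> C * (R / r) powr \<alpha>"
  have "real (covering_number r (cball x R \<inter> A)) \<le> C * (R / r) powr \<alpha>"
    if "x \<in> A" "0 < r" "r < R" for r R x
  proof -
    have "covering_number r (cball x R \<inter> A) \<le> covering_number r (cball x R \<inter> B)"
      using that assms by (intro covering_number_mono) (auto simp: bounded_Int)
    moreover have "real (covering_number r (cball x R \<inter> B)) \<le> C * (R / r) powr \<alpha>"
      using C that assms by blast
    ultimately show ?thesis by linarith
  qed
  then show "\<exists>C>0. \<forall>r R. \<forall>x\<in>A. 0 < r \<and> r < R \<longrightarrow>
      real (covering_number r (cball x R \<inter> A)) \<le> C * (R / r) powr \<alpha>" using C(1) by blast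
qed

lemma upper_assouad_spectrum_mono:
  assumes "A \<subseteq> B"
  shows "upper_assouad_spectrum \<theta> A \<le> upper_assouad_spectrum \<theta> B"
  unfolding upper_assouad_spectrum_def
proof (rule INF_superset_mono[OF _ order_refl], safe)
  fix \<alpha> C :: real assume C: "C > 0" "\<forall>r R. \<forall>x\<in>B.
      0 < r \<and> r \<le> R powr (1 / \<theta>) \<and> R powr (1 / \<theta>) < R \<and> R < 1 \<longrightarrow>
      real (covering_number r (cball x R \<inter> B)) \<le> C * (R / r) powr \<alpha>"
  have "real (covering_number r (cball x R \<inter> A)) \<le> C * (R / r) powr \<alpha>"
    if "x \<in> A" "0 < r" "r \<le> R powr (1 / \<theta>)" "R powr (1 / \<theta>) < R" "R < 1" for r R x
  proof -
    have "covering_number r (cball x R \<inter> A) \<le> covering_number r (cball x R \<inter> B)"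
      using that assms by (intro covering_number_mono) (auto simp: bounded_Int)
    moreover have "real (covering_number r (cball x R \<inter> B)) \<le> C * (R / r) powr \<alpha>"
      using C that assms by blast
    ultimately show ?thesis by linarith
  qed
  then show "\<exists>C>0. \<forall>r R. \<forall>x\<in>A.
      0 < r \<and> r \<le> R powr (1 / \<theta>) \<and> R powr (1 / \<theta>) < R \<and> R < 1 \<longrightarrow>
      real (covering_number r (cball x R \<inter> A)) \<le> C * (R / r) powr \<alpha>" using C(1) by blast
qed

lemma Delta_mono:
  assumes "A \<subseteq> B" "\<theta> < 1"
  shows "Delta m \<theta> A \<le> Delta m \<theta> B"
  unfolding Delta_def
  using assms
  by (intro max.mono order_refl ereal_minus_mono ereal_mult_right_mono
      upper_assouad_spectrum_mono assouad_dim_mono) auto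

text \<open>The ambient dimension bounds both Assouad quantities from above, and the 0 in the
  maximum bounds \<open>Delta\<close> from below. A real value lets \<open>Delta\<close> be moved
  across inequalities in \<open>ereal\<close>.\<close>

lemma Delta_finite:
  fixes F :: "'a::euclidean_space set"
  assumes "\<theta> < 1"
  obtains \<delta> where "Delta m \<theta> F = ereal \<delta>"
proof -
  have "assouad_dim F - ereal m \<le> ereal (real DIM('a)) - ereal m"
    by (intro ereal_minus_mono assouad_dim_le_DIM order_refl)
  then have "(assouad_dim F - ereal m) * ereal (1 - \<theta>) \<le> (ereal (real DIM('a)) - ereal m) * ereal (1 - \<theta>)"
    using assms by (intro ereal_mult_right_mono) auto
  moreover have "upper_assouad_spectrum \<theta> F - ereal m \<le> ereal (real DIM('a)) - ereal m"
    by (intro ereal_minus_mono order_refl order_trans[OF upper_assouad_spectrum_le_assouad_dim assouad_dim_le_DIM])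
  ultimately have "Delta m \<theta> F \<le> max 0 (max (ereal (real DIM('a)) - ereal m)
      ((ereal (real DIM('a)) - ereal m) * ereal (1 - \<theta>)))"
    unfolding Delta_def by (intro max.mono order_refl)
  also have "\<dots> < \<infinity>" by (auto simp: max_def)
  finally have "Delta m \<theta> F < \<infinity>" .
  moreover have "0 \<le> Delta m \<theta> F" by (simp add: Delta_def)
  ultimately show ?thesis using that by (cases "Delta m \<theta> F") auto
qed

section \<open>Random projections of a vector\<close>

lemma orth_proj_inner:
  assumes "subspace V" "v \<in> V"
  shows "orth_proj V x \<bullet> v = x \<bullet> v"
proof -
  have "v \<bullet> (x - orth_proj V x) = 0"
    using orth_proj(2)[OF assms(1), of x] assms(2) by (simp add: orthogonal_comp_def orthogonal_def)
  then show ?thesis by (simp add: inner_diff_right inner_commute)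
qed

section \<open>Volumes of slabs around an orthogonal complement\<close>

text \<open>Orthonormal bases of \<open>V\<close> and of its complement together form one of the
  whole space; \<open>T\<close> sends the coordinate axes to it, and \<open>S\<close> collects the
  axes sent into \<open>V\<close>.\<close>

lemma subspace_adapted_rotation:
  fixes V :: "(real^'n) set"
  assumes V: "subspace V"
  obtains T :: "real^'n \<Rightarrow> real^'n" and S where "orthogonal_transformation T" "card S = dim V" "\<And>i. i \<in> S \<Longrightarrow> T (axis i 1) \<in> V"
proof -
  obtain B1 where B1: "B1 \<subseteq> V" "pairwise orthogonal B1" "\<And>x. x \<in> B1 \<Longrightarrow> norm x = 1"
    "independent B1" "card B1 = dim V" "span B1 = V"
    using orthonormal_basis_subspace[OF V] by metis
  obtain B2 where B2: "B2 \<subseteq> V\<^sup>\<bottom>" "pairwise orthogonal B2" "\<And>x. x \<in> B2 \<Longrightarrow> norm x = 1"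
    "independent B2" "card B2 = dim (V\<^sup>\<bottom>)" "span B2 = V\<^sup>\<bottom>"
    using orthonormal_basis_subspace[OF subspace_orthogonal_comp] by metis
  have disj: "B1 \<inter> B2 = {}"
  proof (rule ccontr)
    assume "B1 \<inter> B2 \<noteq> {}"
    then obtain b where b: "b \<in> B1" "b \<in> B2" by blast
    then have "b \<in> V \<inter> V\<^sup>\<bottom>" using B1(1) B2(1) by blast
    then have "b = 0" using orthogonal_Int_0[OF V] by simp
    then show False using B1(3)[OF b(1)] by simp
  qed
  have fin: "finite B1" "finite B2" using B1(4) B2(4) independent_imp_finite by auto
  have orth: "x \<bullet> y = 0" if "x \<in> B1 \<union> B2" "y \<in> B1 \<union> B2" "x \<noteq> y" for x y
  proof -
    have "a \<bullet> b = 0 \<and> b \<bullet> a = 0" if "a \<in> B1" "b \<in> B2" for a b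
    proof -
      have "a \<in> V" "b \<in> V\<^sup>\<bottom>" using that B1(1) B2(1) by auto
      then show ?thesis by (simp add: orthogonal_comp_def orthogonal_def inner_commute)
    qed
    then show ?thesis
      using that B1(2) B2(2) by (auto simp: pairwise_def orthogonal_def)
  qed
  have "dim V + dim (V\<^sup>\<bottom>) = CARD('n)"
    using dim_subspace_orthogonal_to_vectors[of V UNIV] V
    by (simp add: orthogonal_comp_def add.commute)
  then have "card (B1 \<union> B2) = CARD('n)" using B1(5) B2(5) disj fin by (simp add: card_Un_disjoint)
  then obtain h where h: "bij_betw h (UNIV :: 'n set) (B1 \<union> B2)"
    using finite_same_card_bij[of "UNIV :: 'n set" "B1 \<union> B2"] fin by auto
  have hh: "h i \<bullet> h j = (if i = j then 1 else 0)" for i j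
  proof (cases "i = j")
    case True
    have "h i \<in> B1 \<union> B2" using h by (auto simp: bij_betw_def)
    then have "norm (h i) = 1" using B1(3) B2(3) by auto
    then show ?thesis using True by (simp add: norm_eq_1)
  next
    case False
    then have "h i \<noteq> h j" using h by (auto simp: bij_betw_def inj_def)
    moreover have "h i \<in> B1 \<union> B2" "h j \<in> B1 \<union> B2" using h by (auto simp: bij_betw_def)
    ultimately show ?thesis using orth False by auto
  qed
  define T where "T x = (\<Sum>i\<in>UNIV. x $ i *\<^sub>R h i)" for x :: "real^'n"
  have "linear T"
    by (intro linearI) (auto simp: T_def algebra_simps sum.distrib scaleR_sum_right)
  moreover have "T x \<bullet> T y = x \<bullet> y" for x y
  proof -
    have "T x \<bullet> T y = (\<Sum>j\<in>UNIV. \<Sum>i\<in>UNIV. y $ j * (x $ i * (h i \<bullet> h j)))"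
      by (simp add: T_def inner_sum_left inner_sum_right sum_distrib_left sum_distrib_right mult.assoc)
    also have "\<dots> = (\<Sum>i\<in>UNIV. x $ i * y $ i)"
      by (simp add: hh mult.commute if_distrib[of "\<lambda>c. _ * c"] cong: if_cong)
    finally show ?thesis by (simp add: inner_vec_def)
  qed
  ultimately have "orthogonal_transformation T" by (simp add: orthogonal_transformation_def)
  moreover define S where "S = h -` B1"
  moreover have "card S = dim V"
  proof -
    have "h ` S = B1" using h by (auto simp: S_def bij_betw_def image_vimage_eq)
    moreover have "inj_on h S" using h by (auto simp: bij_betw_def inj_on_def)
    ultimately show ?thesis using B1(5) card_image by metis
  qed
  moreover have "T (axis i 1) = h i" for i
    by (simp add: T_def axis_def if_distrib[of "\<lambda>c. c *\<^sub>R _"] cong: if_cong)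
  ultimately show ?thesis using that[of T S] B1(1) by auto
qed

lemma borel_measurable_orth_proj [measurable]:
  assumes "subspace V"
  shows "orth_proj V \<in> borel_measurable borel"
  using linear_orth_proj[OF assms]
  by (intro borel_measurable_continuous_onI linear_continuous_on) (simp add: linear_conv_bounded_linear)

text \<open>A rotation adapted to \<open>V\<close> preserves volume and places the slab in a box
  with half-side \<open>\<rho>\<close> in \<open>m\<close> directions and 1 in the others.\<close>

lemma slab_volume:
  fixes V :: "(real^'n) set"
  assumes V: "V \<in> grassmannian m" and "0 \<le> \<rho>"
  shows "emeasure lborel {x \<in> ball 0 1. norm (orth_proj V x) \<le> \<rho>} \<le> ennreal (2 ^ CARD('n) * \<rho> ^ m)"
proof -
  have sub: "subspace V" and dim: "dim V = m" using V by (auto simp: grassmannian_def)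
  note [measurable] = borel_measurable_orth_proj[OF sub]
  obtain T :: "real^'n \<Rightarrow> real^'n" and S where T: "orthogonal_transformation T" and S: "card S = dim V" "\<And>i. i \<in> S \<Longrightarrow> T (axis i 1) \<in> V"
    using subspace_adapted_rotation[OF sub] by metis
  have [measurable]: "T \<in> borel_measurable borel"
    by (intro borel_measurable_continuous_onI linear_continuous_on
        linear_conv_bounded_linear[THEN iffD1] orthogonal_transformation_linear[OF T])
  define A where "A = {x \<in> ball 0 1. norm (orth_proj V x) \<le> \<rho>}"
  have [measurable]: "A \<in> sets borel" unfolding A_def by measurable
  define u :: "real^'n" where "u = (\<chi> i. if i \<in> S then \<rho> else 1)"
  have "T -` A \<subseteq> cbox (- u) u"
  proof
    fix x assume "x \<in> T -` A"
    then have x: "norm (T x) < 1" "norm (orth_proj V (T x)) \<le> \<rho>" by (auto simp: A_def)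
    have "\<bar>x $ i\<bar> \<le> u $ i" for i
    proof (cases "i \<in> S")
      case True
      have 1: "norm (T (axis i 1)) = 1" using T by (simp add: orthogonal_transformation_norm)
      have "x $ i = T x \<bullet> T (axis i 1)"
        using T by (simp add: orthogonal_transformation_def inner_axis)
      also have "\<dots> = orth_proj V (T x) \<bullet> T (axis i 1)"
        using orth_proj_inner[OF sub S(2)[OF True]] by simp
      finally have "\<bar>x $ i\<bar> \<le> norm (orth_proj V (T x)) * norm (T (axis i 1))"
        by (simp add: Cauchy_Schwarz_ineq2)
      then show ?thesis using x(2) True 1 by (simp add: u_def)
    next
      case False
      have "\<bar>x $ i\<bar> \<le> norm x" by (rule component_le_norm_cart)
      also have "\<dots> = norm (T x)" using T by (simp add: orthogonal_transformation_norm)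
      finally show ?thesis using x(1) False by (simp add: u_def)
    qed
    then show "x \<in> cbox (- u) u" by (simp add: mem_box_cart abs_le_iff minus_le_iff)
  qed
  have "emeasure lborel A = emeasure (distr lborel borel T) A" by (simp add: distr_lborel_orthogonal[OF T])
  also have "\<dots> = emeasure lborel (T -` A)" by (subst emeasure_distr) auto
  also have "\<dots> \<le> emeasure lborel (cbox (- u) u)"
    by (intro emeasure_mono \<open>T -` A \<subseteq> _\<close>) auto
  also have "\<dots> = ennreal (measure lborel (cbox (- u) u))"
    using emeasure_bounded_finite[OF bounded_cbox] by (intro emeasure_eq_ennreal_measure) (auto simp: less_top)
  also have "measure lborel (cbox (- u) u) = (\<Prod>i\<in>UNIV. u $ i - (- u) $ i)"
    using assms(2) by (intro content_cbox_cart) (auto simp: interval_ne_empty_cart u_def)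
  also have "\<dots> = (\<Prod>i\<in>(UNIV::'n set). 2 * (if i \<in> S then \<rho> else 1))"
    by (intro prod.cong) (auto simp: u_def)
  also have "\<dots> = 2 ^ CARD('n) * \<rho> ^ m"
    using S(1) dim by (simp add: prod.distrib prod.If_cases)
  finally show ?thesis by (simp add: A_def)
qed

section \<open>Joint measurability and the small-ball estimate\<close>

text \<open>The projection is the continuous matrix-vector product applied to
  \<open>matrix (orth_proj V)\<close>, which is measurable by the choice of
  \<open>grassmann_borel\<close>. Joint measurability is needed for Fubini's theorem below.\<close>

lemma measurable_orth_proj_pair:
  "(\<lambda>(V, x). orth_proj V x) \<in> borel_measurable (grassmann_borel m \<Otimes>\<^sub>M (borel :: (real^'n) measure))"
proof -
  have P[measurable]: "(\<lambda>V. matrix (orth_proj V)) \<in> borel_measurable (grassmann_borel m :: (real^'n) set measure)"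
    unfolding grassmann_borel_def by (rule measurable_vimage_algebra1) auto
  have "continuous_on UNIV (\<lambda>p :: (real^'n^'n) \<times> (real^'n). fst p *v snd p)"
    unfolding matrix_vector_mult_def by (intro continuous_intros)
  then have c: "(\<lambda>p :: (real^'n^'n) \<times> (real^'n). fst p *v snd p) \<in> borel_measurable borel"
    by (rule borel_measurable_continuous_onI)
  have "(\<lambda>p. (\<lambda>p. fst p *v snd p) (matrix (orth_proj (fst p)), snd p))
      \<in> borel_measurable (grassmann_borel m \<Otimes>\<^sub>M (borel :: (real^'n) measure))"
    by (rule measurable_compose[OF _ c]) measurable
  then show ?thesis
    by (subst measurable_cong[where g = "\<lambda>p. matrix (orth_proj (fst p)) *v snd p"])
      (auto simp: space_pair_measure grassmann_borel_def grassmannian_def linear_orth_proj matrix_works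
        split_beta)
qed

lemma invariant_grassmann_measureD:
  assumes "invariant_grassmann_measure m \<gamma>"
  shows "prob_space \<gamma>" "sets \<gamma> = sets (grassmann_borel m)" "space \<gamma> = grassmannian m"
    "orthogonal_transformation g \<Longrightarrow> distr \<gamma> \<gamma> (\<lambda>V. g ` V) = \<gamma>"
  using assms sets_eq_imp_space_eq[of \<gamma> "grassmann_borel m"]
  by (auto simp: invariant_grassmann_measure_def grassmann_borel_def)

lemma measurable_orth_proj_le:
  fixes \<gamma> :: "(real^'n) set measure"
  assumes "sets \<gamma> = sets (grassmann_borel m)"
  shows "{V \<in> space \<gamma>. norm (orth_proj V z) \<le> r} \<in> sets \<gamma>"
proof -
  have pm: "(\<lambda>p. orth_proj (fst p) (snd p)) \<in> borel_measurable (\<gamma> \<Otimes>\<^sub>M (borel :: (real^'n) measure))"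
    using measurable_orth_proj_pair[of m, where 'n = 'n]
    by (simp add: split_beta measurable_cong_sets[OF sets_pair_measure_cong[OF assms refl] refl])
  have [measurable]: "(\<lambda>V. orth_proj V z) \<in> borel_measurable \<gamma>"
    by (rule measurable_compose[OF _ pm, of "\<lambda>V. (V, z)", simplified]) auto
  show ?thesis by measurable
qed

text \<open>
  By invariance the probability depends only on \<open>r / norm x\<close>, so it can be averaged over \<open>x\<close> in the
  unit ball; after exchanging the integrals only the volume of a slab for fixed \<open>V\<close> is needed.
\<close>

lemma projection_small_ball:
  fixes \<gamma> :: "(real^'n) set measure"
  assumes "invariant_grassmann_measure m \<gamma>"
  obtains c where "c > 0" "\<And>x r. x \<noteq> 0 \<Longrightarrow> 0 \<le> r \<Longrightarrow>
    emeasure \<gamma> {V \<in> space \<gamma>. norm (orth_proj V x) \<le> r} \<le> ennreal (c * (r / norm x) ^ m)"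
proof -
  note sets[measurable_cong] = invariant_grassmann_measureD(2)[OF assms]
    and space = invariant_grassmann_measureD(3)[OF assms]
    and inv = invariant_grassmann_measureD(4)[OF assms]
  interpret prob_space \<gamma> by (rule invariant_grassmann_measureD(1)[OF assms])
  have pm[measurable]: "(\<lambda>p. orth_proj (fst p) (snd p)) \<in> borel_measurable (\<gamma> \<Otimes>\<^sub>M (borel :: (real^'n) measure))"
    using measurable_orth_proj_pair[of m, where 'n = 'n]
    by (simp add: split_beta measurable_cong_sets[OF sets_pair_measure_cong[OF sets refl] refl])
  define p where "p x r = emeasure \<gamma> {V \<in> space \<gamma>. norm (orth_proj V x) \<le> r}" for x :: "real^'n" and r
  have sub: "subspace V" if "V \<in> space \<gamma>" for V using that by (simp add: space grassmannian_def)
  have om[measurable]: "(\<lambda>V. orth_proj V x) \<in> borel_measurable \<gamma>" for x :: "real^'n"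
    by (rule measurable_compose[OF _ pm, of "\<lambda>V. (V, x)", simplified]) auto
  have pg: "p (g x) r = p x r" if g: "orthogonal_transformation g" for g x r
  proof -
    have gm: "(\<lambda>V. g ` V) \<in> measurable \<gamma> \<gamma>"
      using measurable_grassmannian_image[OF g, of m] by (simp add: measurable_cong_sets[OF sets sets])
    have gs: "g ` V \<in> space \<gamma>" if "V \<in> space \<gamma>" for V using measurable_space[OF gm that] .
    have "p (g x) r = emeasure (distr \<gamma> \<gamma> (\<lambda>V. g ` V)) {V \<in> space \<gamma>. norm (orth_proj V (g x)) \<le> r}"
      by (simp add: p_def inv[OF g])
    also have "\<dots> = emeasure \<gamma> ((\<lambda>V. g ` V) -` {V \<in> space \<gamma>. norm (orth_proj V (g x)) \<le> r} \<inter> space \<gamma>)"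
      by (rule emeasure_distr[OF gm]) measurable
    also have "(\<lambda>V. g ` V) -` {V \<in> space \<gamma>. norm (orth_proj V (g x)) \<le> r} \<inter> space \<gamma>
        = {V \<in> space \<gamma>. norm (orth_proj V x) \<le> r}"
      using gs orthogonal_transformation_norm[OF g] by (auto simp: orth_proj_image[OF g] sub)
    finally show ?thesis by (simp add: p_def)
  qed
  define w where "w = measure lborel (ball (0::real^'n) 1)"
  have w: "w > 0" by (simp add: w_def content_ball_pos)
  have ew: "emeasure lborel (ball (0::real^'n) 1) = ennreal w"
    unfolding w_def using emeasure_bounded_finite[OF bounded_ball]
    by (intro emeasure_eq_ennreal_measure) (auto simp: less_top)
  define c where "c = 2 ^ CARD('n) / w"
  have unit: "p e \<rho> \<le> ennreal (c * \<rho> ^ m)" if e: "norm e = 1" and \<rho>: "0 \<le> \<rho>" for e \<rho>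
  proof -
    \<comment> \<open>\<open>x\<close> is a rotated copy of \<open>e\<close> scaled by
      \<open>norm x\<close>, which is less than 1. Scaling down shortens all projections and so only
      enlarges the event.\<close>
    have le: "p e \<rho> \<le> p x \<rho>" if x: "x \<in> ball 0 1" for x
    proof -
      obtain g where g: "orthogonal_transformation g" "x = norm x *\<^sub>R g e"
      proof (cases "x = 0")
        case True
        then show ?thesis using that[of id] by (simp add: orthogonal_transformation_id[unfolded id_def[symmetric]])
      next
        case False
        then have "norm e = norm (x /\<^sub>R norm x)" using e by simp
        then obtain g where "orthogonal_transformation g" "g e = x /\<^sub>R norm x"
          using orthogonal_transformation_exists by metis
        then show ?thesis using that[of g] False by simp
      qed
      have "p e \<rho> = p (g e) \<rho>" using pg[OF g(1)] by simp
      also have "\<dots> \<le> p x \<rho>"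
        unfolding p_def
      proof (rule emeasure_mono)
        have "norm (orth_proj V x) \<le> \<rho>" if V: "V \<in> space \<gamma>" "norm (orth_proj V (g e)) \<le> \<rho>" for V
        proof -
          have "orth_proj V x = norm x *\<^sub>R orth_proj V (g e)"
            using linear_scale[OF linear_orth_proj[OF sub[OF V(1)]], of "norm x" "g e"] g(2) by simp
          then have "norm (orth_proj V x) = norm x * norm (orth_proj V (g e))" by simp
          also have "\<dots> \<le> 1 * norm (orth_proj V (g e))" using x by (intro mult_right_mono) auto
          finally show ?thesis using V(2) by simp
        qed
        then show "{V \<in> space \<gamma>. norm (orth_proj V (g e)) \<le> \<rho>} \<subseteq> {V \<in> space \<gamma>. norm (orth_proj V x) \<le> \<rho>}"
          by auto
      qed measurable
      finally show ?thesis .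
    qed
    interpret P: pair_sigma_finite \<gamma> "lborel :: (real^'n) measure" ..
    let ?J = "\<lambda>V x. indicator (ball 0 1) x * indicator {x. norm (orth_proj V x) \<le> \<rho>} x :: ennreal"
    have Jm: "(\<lambda>(V, x). ?J V x) \<in> borel_measurable (\<gamma> \<Otimes>\<^sub>M (lborel :: (real^'n) measure))"
    proof -
      have "(\<lambda>z. if norm (snd z) < 1 \<and> norm (orth_proj (fst z) (snd z)) \<le> \<rho> then 1 else 0 :: ennreal)
        \<in> borel_measurable (\<gamma> \<Otimes>\<^sub>M (borel :: (real^'n) measure))" by measurable
      also have "(\<lambda>z. if norm (snd z) < 1 \<and> norm (orth_proj (fst z) (snd z)) \<le> \<rho> then 1 else 0 :: ennreal)
        = (\<lambda>(V, x). ?J V x)" by (auto simp: indicator_def)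
      finally show ?thesis
        by (simp only: measurable_cong_sets[OF sets_pair_measure_cong[OF refl sets_lborel] refl])
    qed
    have "p e \<rho> * ennreal w = (\<integral>\<^sup>+x. p e \<rho> * indicator (ball (0::real^'n) 1) x \<partial>lborel)"
      by (simp add: nn_integral_cmult_indicator ew)
    also have "\<dots> \<le> (\<integral>\<^sup>+x. (\<integral>\<^sup>+V. ?J V x \<partial>\<gamma>) \<partial>lborel)"
    proof (rule nn_integral_mono)
      fix x :: "real^'n"
      have "(\<integral>\<^sup>+V. ?J V x \<partial>\<gamma>) = (\<integral>\<^sup>+V. indicator (ball 0 1) x * indicator {V \<in> space \<gamma>. norm (orth_proj V x) \<le> \<rho>} V \<partial>\<gamma>)"
        by (intro nn_integral_cong) (auto simp: indicator_def)
      also have "\<dots> = indicator (ball 0 1) x * p x \<rho>"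
        unfolding p_def by (rule nn_integral_cmult_indicator) measurable
      finally show "p e \<rho> * indicator (ball 0 1) x \<le> (\<integral>\<^sup>+V. ?J V x \<partial>\<gamma>)"
        using le[of x] by (auto simp: indicator_def)
    qed
    also have "\<dots> = (\<integral>\<^sup>+V. (\<integral>\<^sup>+x. ?J V x \<partial>lborel) \<partial>\<gamma>)"
      by (rule P.Fubini'[OF Jm])
    also have "\<dots> \<le> (\<integral>\<^sup>+V. ennreal (2 ^ CARD('n) * \<rho> ^ m) \<partial>\<gamma>)"
    proof (rule nn_integral_mono)
      fix V assume V: "V \<in> space \<gamma>"
      note [measurable] = borel_measurable_orth_proj[OF sub[OF V]]
      have "(\<integral>\<^sup>+x. ?J V x \<partial>lborel) = (\<integral>\<^sup>+x. indicator {x \<in> ball 0 1. norm (orth_proj V x) \<le> \<rho>} x \<partial>lborel)"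
        by (intro nn_integral_cong) (auto simp: indicator_def)
      also have "\<dots> = emeasure lborel {x \<in> ball 0 1. norm (orth_proj V x) \<le> \<rho>}"
        by (rule nn_integral_indicator) measurable
      also have "\<dots> \<le> ennreal (2 ^ CARD('n) * \<rho> ^ m)"
        using slab_volume V \<rho> space by blast
      finally show "(\<integral>\<^sup>+x. ?J V x \<partial>lborel) \<le> ennreal (2 ^ CARD('n) * \<rho> ^ m)" .
    qed
    also have "\<dots> = ennreal (2 ^ CARD('n) * \<rho> ^ m)" by (simp add: emeasure_space_1)
    also have "\<dots> = ennreal (c * \<rho> ^ m) * ennreal w"
      using w \<rho> by (simp add: c_def ennreal_mult'[symmetric])
    finally show ?thesis
      using w by (simp add: ennreal_mult_le_mult_iff mult.commute[of _ "ennreal w"])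
  qed
  show ?thesis
  proof (rule that)
    show "c > 0" using w by (simp add: c_def)
    fix x :: "real^'n" and r :: real assume x: "x \<noteq> 0" "0 \<le> r"
    have "{V \<in> space \<gamma>. norm (orth_proj V x) \<le> r} = {V \<in> space \<gamma>. norm (orth_proj V (x /\<^sub>R norm x)) \<le> r / norm x}"
    proof (rule Collect_cong, rule conj_cong[OF refl])
      fix V assume "V \<in> space \<gamma>"
      then have "orth_proj V (x /\<^sub>R norm x) = orth_proj V x /\<^sub>R norm x"
        using linear_scale[OF linear_orth_proj[OF sub]] by blast
      then show "norm (orth_proj V x) \<le> r \<longleftrightarrow> norm (orth_proj V (x /\<^sub>R norm x)) \<le> r / norm x"
        using x by (simp add: field_simps)
    qed
    then show "emeasure \<gamma> {V \<in> space \<gamma>. norm (orth_proj V x) \<le> r} \<le> ennreal (c * (r / norm x) ^ m)"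
      using unit[of "x /\<^sub>R norm x" "r / norm x"] x by (simp add: p_def)
  qed
qed

section \<open>Energies of separated sets\<close>

text \<open>A number strictly above \<open>Delta\<close> leaves room above both infima, so
  admissible exponents \<open>\<alpha>\<close> and \<open>\<beta>\<close> can be chosen below the
  resulting thresholds; \<open>0 < D\<close> comes from the 0 in the maximum.\<close>

lemma Delta_lessE:
  fixes F :: "'a::euclidean_space set"
  assumes "\<theta> < 1" "Delta m \<theta> F < ereal D"
  obtains \<alpha> C \<beta> B where "0 < D" "\<alpha> - real m \<le> D" "0 < C"
    "\<And>r R x. x \<in> F \<Longrightarrow> 0 < r \<Longrightarrow> r \<le> R powr (1 / \<theta>) \<Longrightarrow> R powr (1 / \<theta>) < R \<Longrightarrow> R < 1 \<Longrightarrow>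
      real (covering_number r (cball x R \<inter> F)) \<le> C * (R / r) powr \<alpha>"
    "(\<beta> - real m) * (1 - \<theta>) \<le> D" "0 < B"
    "\<And>r R x. x \<in> F \<Longrightarrow> 0 < r \<Longrightarrow> r < R \<Longrightarrow>
      real (covering_number r (cball x R \<inter> F)) \<le> B * (R / r) powr \<beta>"
proof -
  have D: "0 < D" and S: "upper_assouad_spectrum \<theta> F - ereal m < D"
    and A: "(assouad_dim F - ereal m) * ereal (1 - \<theta>) < D"
    using assms(2) by (auto simp: Delta_def)
  have "upper_assouad_spectrum \<theta> F < ereal (D + m)"
    using S by (cases "upper_assouad_spectrum \<theta> F") auto
  then obtain \<alpha> C where \<alpha>: "\<alpha> < D + m" "0 < C" "\<forall>r R. \<forall>x\<in>F.
      0 < r \<and> r \<le> R powr (1 / \<theta>) \<and> R powr (1 / \<theta>) < R \<and> R < 1 \<longrightarrow>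
      real (covering_number r (cball x R \<inter> F)) \<le> C * (R / r) powr \<alpha>"
    unfolding upper_assouad_spectrum_def INF_less_iff by auto
  have "assouad_dim F < ereal (m + D / (1 - \<theta>))"
    using A assms(1) by (cases "assouad_dim F") (auto simp: field_simps)
  then obtain \<beta> B where \<beta>: "\<beta> < m + D / (1 - \<theta>)" "0 < B" "\<forall>r R. \<forall>x\<in>F. 0 < r \<and> r < R \<longrightarrow>
      real (covering_number r (cball x R \<inter> F)) \<le> B * (R / r) powr \<beta>"
    unfolding assouad_dim_def INF_less_iff by auto
  have "(\<beta> - m) * (1 - \<theta>) \<le> D" using \<beta>(1) assms(1) by (simp add: field_simps)
  then show ?thesis using that[of \<alpha> C \<beta> B] D \<alpha> \<beta> by auto
qed

text \<open>Applied with \<open>t = R / \<sigma>\<close>. The exponent \<open>b\<close> may have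
  either sign: for \<open>b \<le> 0\<close> the power is at most 1, otherwise the upper bound on
  \<open>t\<close> is raised to it.\<close>

lemma powr_le_powr_uminus:
  fixes t \<sigma> b e D :: real
  assumes "1 \<le> t" "t \<le> \<sigma> powr - e" "b * e \<le> D" "0 \<le> D" "0 < \<sigma>" "\<sigma> < 1"
  shows "t powr b \<le> \<sigma> powr - D"
proof (cases "b \<le> 0")
  case True
  then have "t powr b \<le> t powr 0" using assms(1) by (intro powr_mono) auto
  also have "\<dots> \<le> \<sigma> powr 0" using assms by simp
  also have "\<dots> \<le> \<sigma> powr - D" using assms by (intro powr_mono') auto
  finally show ?thesis .
next
  case False
  then have "t powr b \<le> (\<sigma> powr - e) powr b" using assms by (intro powr_mono2) auto
  also have "\<dots> = \<sigma> powr - (b * e)" by (simp add: powr_powr mult.commute)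
  also have "\<dots> \<le> \<sigma> powr - D" using assms by (intro powr_mono') auto
  finally show ?thesis .
qed

text \<open>The factor \<open>(\<sigma> / R) ^ m\<close> turns a count
  \<open>(R / \<sigma>) powr a\<close> into \<open>(R / \<sigma>) powr (a - m)\<close>. For
  \<open>R\<close> up to \<open>\<sigma> powr \<theta>\<close> the ratio \<open>R / \<sigma>\<close>
  is at most \<open>\<sigma> powr - (1 - \<theta>)\<close>, and for larger \<open>R < 1\<close> at
  most \<open>\<sigma> powr - 1\<close>; these exponents match the two non-trivial terms of
  \<open>Delta\<close>.\<close>

lemma separated_in_cball_bound:
  fixes F :: "'a::euclidean_space set"
  assumes "bounded F" "0 < \<theta>" "\<theta> < 1" "Delta m \<theta> F < ereal D"
  obtains K \<sigma>\<^sub>0 :: real where "0 < K" "0 < \<sigma>\<^sub>0"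
    "\<And>\<sigma> R P x. 0 < \<sigma> \<Longrightarrow> \<sigma> \<le> \<sigma>\<^sub>0 \<Longrightarrow> \<sigma> < R \<Longrightarrow> P \<subseteq> F \<Longrightarrow> separated \<sigma> P \<Longrightarrow> x \<in> P \<Longrightarrow>
      (\<sigma> / R) ^ m * real (card (P \<inter> cball x R)) \<le> K * \<sigma> powr - D"
proof -
  obtain \<alpha> C \<beta> B where D: "0 < D" and \<alpha>: "\<alpha> - real m \<le> D" "0 < C"
    "\<And>r R x. x \<in> F \<Longrightarrow> 0 < r \<Longrightarrow> r \<le> R powr (1 / \<theta>) \<Longrightarrow> R powr (1 / \<theta>) < R \<Longrightarrow> R < 1 \<Longrightarrow>
      real (covering_number r (cball x R \<inter> F)) \<le> C * (R / r) powr \<alpha>"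
    and \<beta>: "(\<beta> - real m) * (1 - \<theta>) \<le> D" "0 < B"
    "\<And>r R x. x \<in> F \<Longrightarrow> 0 < r \<Longrightarrow> r < R \<Longrightarrow>
      real (covering_number r (cball x R \<inter> F)) \<le> B * (R / r) powr \<beta>"
    using Delta_lessE[OF assms(3,4)] by metis
  \<comment> \<open>A finite net of \<open>F\<close>; for \<open>R \<ge> 1\<close> all of
    \<open>P\<close> is counted through the balls of radius 1/2 around it.\<close>
  obtain X where X: "X \<subseteq> F" "finite X" "F \<subseteq> (\<Union>p\<in>X. cball p (1/2))"
    using maximal_separated_exists[OF assms(1), of "1/2"] by (metis half_gt_zero_iff zero_less_one)
  have self: "R powr (1 / \<theta>) < R" if "0 < R" "R < 1" for R :: real
  proof -
    have "R powr (1 / \<theta>) < R powr 1" using that assms by (intro powr_less_mono') auto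
    then show ?thesis using that by simp
  qed
  \<comment> \<open>The largest scale at which the spectrum bound is available for
    \<open>R = 1/2\<close>.\<close>
  define \<sigma>\<^sub>0 :: real where "\<sigma>\<^sub>0 = (1/2) powr (1 / \<theta>)"
  define E where "E = real (card X) * C * (1/2) powr \<alpha>"
  have E: "E \<ge> 0" using \<alpha>(2) by (simp add: E_def)
  show ?thesis
  proof (rule that)
    show "0 < C + B + E" using \<alpha>(2) \<beta>(2) E by simp
    show "0 < \<sigma>\<^sub>0" by (simp add: \<sigma>\<^sub>0_def)
    fix \<sigma> R P x assume \<sigma>: "0 < \<sigma>" "\<sigma> \<le> \<sigma>\<^sub>0" "\<sigma> < R" and P: "P \<subseteq> F" "separated \<sigma> P" "x \<in> P"
    have \<sigma>1: "\<sigma> < 1/2" using \<sigma>(2) self[of "1/2"] by (simp add: \<sigma>\<^sub>0_def)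
    have cnt: "real (card (P \<inter> cball z s)) \<le> real (covering_number \<sigma> (cball z s \<inter> F))" for z s
      using separated_card_le[of "cball z s \<inter> F" \<sigma> "P \<inter> cball z s"] P \<sigma>
      by (auto simp: bounded_Int intro: separated_subset)
    have xF: "x \<in> F" using P by auto
    have t1: "1 \<le> R / \<sigma>" using \<sigma> by simp
    have pw: "(\<sigma> / R) ^ m * (R / \<sigma>) powr a = (R / \<sigma>) powr (a - m)" for a
      using \<sigma> by (simp add: powr_diff powr_realpow power_divide field_simps)
    have Dpos: "0 \<le> \<sigma> powr - D" by simp
    have split: "K1 * \<sigma> powr - D \<le> (C + B + E) * \<sigma> powr - D" if "K1 \<le> C + B + E" for K1
      using that by (intro mult_right_mono) auto
    \<comment> \<open>The Assouad dimension controls small \<open>R\<close>, the spectrum intermediate \<open>R\<close>, and boundedness of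
      \<open>F\<close> together with the spectrum at the fixed scale \<open>1/2\<close> controls large \<open>R\<close>.\<close>
    consider "R powr (1 / \<theta>) < \<sigma>" | "\<sigma> \<le> R powr (1 / \<theta>)" "R < 1" | "1 \<le> R" by linarith
    then show "(\<sigma> / R) ^ m * real (card (P \<inter> cball x R)) \<le> (C + B + E) * \<sigma> powr - D"
    proof cases
      case 1
      have "(R powr (1 / \<theta>)) powr \<theta> \<le> \<sigma> powr \<theta>" using 1 assms \<sigma> by (intro powr_mono2) auto
      then have "R \<le> \<sigma> powr \<theta>" using \<sigma> assms by (simp add: powr_powr)
      then have "R / \<sigma> \<le> \<sigma> powr \<theta> / \<sigma> powr 1" using \<sigma> by (simp add: divide_right_mono)
      then have t2: "R / \<sigma> \<le> \<sigma> powr - (1 - \<theta>)" using \<sigma>(1) by (simp add: powr_diff)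
      have "(\<sigma> / R) ^ m * real (card (P \<inter> cball x R)) \<le> (\<sigma> / R) ^ m * (B * (R / \<sigma>) powr \<beta>)"
        using \<sigma> by (intro mult_left_mono order_trans[OF cnt \<beta>(3)] xF) auto
      also have "\<dots> = B * (R / \<sigma>) powr (\<beta> - m)" by (subst pw[symmetric]) simp
      also have "\<dots> \<le> B * \<sigma> powr - D"
        using \<beta>(1,2) D \<sigma> \<sigma>1 by (intro mult_left_mono powr_le_powr_uminus[OF t1 t2]) auto
      finally show ?thesis using split[of B] \<alpha>(2) E by linarith
    next
      case 2
      have t2: "R / \<sigma> \<le> \<sigma> powr - 1" using 2 \<sigma> by (simp add: powr_minus divide_inverse)
      have "(\<sigma> / R) ^ m * real (card (P \<inter> cball x R)) \<le> (\<sigma> / R) ^ m * (C * (R / \<sigma>) powr \<alpha>)"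
        using \<sigma> 2 self[of R] by (intro mult_left_mono order_trans[OF cnt \<alpha>(3)] xF) auto
      also have "\<dots> = C * (R / \<sigma>) powr (\<alpha> - m)" by (subst pw[symmetric]) simp
      also have "\<dots> \<le> C * \<sigma> powr - D"
        using \<alpha>(1,2) D \<sigma> \<sigma>1 by (intro mult_left_mono powr_le_powr_uminus[OF t1 t2]) auto
      finally show ?thesis using split[of C] \<beta>(2) E by linarith
    next
      case 3
      have finP: "finite P" using separated_card_le[OF assms(1) \<sigma>(1) P(1,2)] by simp
      have "P \<subseteq> (\<Union>z\<in>X. P \<inter> cball z (1/2))" using P(1) X(3) by blast
      then have "card P \<le> card (\<Union>z\<in>X. P \<inter> cball z (1/2))" using finP X(2) by (intro card_mono) auto
      also have "\<dots> \<le> (\<Sum>z\<in>X. card (P \<inter> cball z (1/2)))" by (rule card_UN_le[OF X(2)])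
      finally have "real (card P) \<le> (\<Sum>z\<in>X. real (card (P \<inter> cball z (1/2))))"
        by (metis of_nat_mono of_nat_sum)
      also have "\<dots> \<le> (\<Sum>z\<in>X. C * ((1/2) / \<sigma>) powr \<alpha>)"
        using X(1) \<sigma> self[of "1/2"] by (intro sum_mono order_trans[OF cnt \<alpha>(3)]) (auto simp: \<sigma>\<^sub>0_def)
      also have "\<dots> = E * (1 / \<sigma>) powr \<alpha>"
        using \<sigma>(1) by (simp add: E_def powr_divide powr_mult)
      finally have card: "real (card P) \<le> E * (1 / \<sigma>) powr \<alpha>" .
      have t: "1 \<le> 1 / \<sigma>" "1 / \<sigma> \<le> \<sigma> powr - 1" using \<sigma> \<sigma>1 by (simp_all add: powr_minus_divide)
      have "(\<sigma> / R) ^ m * real (card (P \<inter> cball x R)) \<le> \<sigma> ^ m * (E * (1 / \<sigma>) powr \<alpha>)"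
      proof (intro mult_mono)
        have "\<sigma> / R \<le> \<sigma>" using 3 \<sigma> by (simp add: field_simps)
        then show "(\<sigma> / R) ^ m \<le> \<sigma> ^ m" using \<sigma> 3 by (intro power_mono) auto
        have "card (P \<inter> cball x R) \<le> card P" using finP by (intro card_mono) auto
        then show "real (card (P \<inter> cball x R)) \<le> E * (1 / \<sigma>) powr \<alpha>" using card by linarith
      qed (use \<sigma> in auto)
      also have "\<dots> = E * (1 / \<sigma>) powr (\<alpha> - m)"
        using \<sigma> by (simp add: powr_diff powr_realpow power_divide field_simps)
      also have "\<dots> \<le> E * \<sigma> powr - D"
        using \<alpha>(1) E D \<sigma> \<sigma>1 by (intro mult_left_mono powr_le_powr_uminus[OF t]) auto
      finally show ?thesis using split[of E] \<beta>(2) \<alpha>(2) by linarith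
    qed
  qed
qed

text \<open>Each dyadic shell around \<open>x\<close> contributes at most a constant times
  \<open>\<sigma> powr - D\<close>, whatever its radius, so the sum is governed by the number of
  shells.\<close>

lemma separated_energy_bound:
  fixes F :: "'a::euclidean_space set"
  assumes "bounded F" "0 < \<theta>" "\<theta> < 1" "Delta m \<theta> F < ereal D"
  obtains K \<sigma>\<^sub>0 :: real and l :: nat where "0 < K" "0 < \<sigma>\<^sub>0"
    "\<And>k P x. (1/2) ^ k \<le> \<sigma>\<^sub>0 \<Longrightarrow> P \<subseteq> F \<Longrightarrow> separated ((1/2) ^ k) P \<Longrightarrow> x \<in> P \<Longrightarrow>
      (\<Sum>y\<in>P - {x}. ((1/2) ^ k / dist x y) ^ m) \<le> K * real (k + l) * ((1/2) ^ k) powr - D"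
proof -
  obtain K \<sigma>\<^sub>0 where K: "0 < K" "0 < \<sigma>\<^sub>0"
    "\<And>\<sigma> R P x. 0 < \<sigma> \<Longrightarrow> \<sigma> \<le> \<sigma>\<^sub>0 \<Longrightarrow> \<sigma> < R \<Longrightarrow> P \<subseteq> F \<Longrightarrow> separated \<sigma> P \<Longrightarrow> x \<in> P \<Longrightarrow>
      (\<sigma> / R) ^ m * real (card (P \<inter> cball x R)) \<le> K * \<sigma> powr - D"
    using separated_in_cball_bound[OF assms] by metis
  \<comment> \<open>In units of \<open>(1/2) ^ k\<close> all distances in \<open>F\<close> stay
    below \<open>2 ^ (k + l)\<close>, so at most \<open>k + l\<close> shells occur.\<close>
  obtain l where "diameter F < 2 ^ l" using real_arch_pow[of 2 "diameter F"] by auto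
  then have l: "dist x y < 2 ^ l" if "x \<in> F" "y \<in> F" for x y
    using diameter_bounded_bound[OF assms(1) that] by linarith
  show ?thesis
  proof (rule that[of "2 ^ m * K" \<sigma>\<^sub>0 l])
    show "0 < 2 ^ m * K" "0 < \<sigma>\<^sub>0" using K by auto
    fix k P x assume k: "(1/2) ^ k \<le> \<sigma>\<^sub>0" and P: "P \<subseteq> F" "separated ((1/2) ^ k) P" "x \<in> P"
    define \<sigma> :: real where "\<sigma> = (1/2) ^ k"
    have \<sigma>: "0 < \<sigma>" "2 ^ k * \<sigma> = 1" by (simp_all add: \<sigma>_def power_divide)
    have finP: "finite P" using separated_card_le[OF assms(1) \<sigma>(1) P(1)] P(2) by (simp add: \<sigma>_def)
    define A where "A j = {y \<in> P - {x}. 2 ^ j * \<sigma> < dist x y \<and> dist x y \<le> 2 ^ (j + 1) * \<sigma>}" for j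
    define f where "f y = (\<sigma> / dist x y) ^ m" for y
    have f0: "0 \<le> f y" for y using \<sigma> by (simp add: f_def)
    have shell: "\<exists>j<k + l. y \<in> A j" if y: "y \<in> P - {x}" for y
    proof -
      have d: "\<sigma> < dist x y" using y P by (auto simp: separated_def \<sigma>_def)
      define j where "j = (LEAST j. dist x y \<le> 2 ^ (j + 1) * \<sigma>)"
      obtain N where "dist x y / \<sigma> < 2 ^ N" using real_arch_pow[of 2 "dist x y / \<sigma>"] by auto
      also have "(2::real) ^ N \<le> 2 ^ (N + 1)" by simp
      finally have ex: "dist x y \<le> 2 ^ (N + 1) * \<sigma>" using \<sigma> by (simp add: field_simps)
      have up: "dist x y \<le> 2 ^ (j + 1) * \<sigma>"
        unfolding j_def by (rule LeastI[of "\<lambda>j. dist x y \<le> 2 ^ (j + 1) * \<sigma>", OF ex])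
      \<comment> \<open>For \<open>j = 0\<close> this is the separation of \<open>P\<close>,
        otherwise the minimality of \<open>j\<close>.\<close>
      have lo: "2 ^ j * \<sigma> < dist x y"
      proof (cases j)
        case 0
        then show ?thesis using d by simp
      next
        case (Suc i)
        then have "\<not> dist x y \<le> 2 ^ (i + 1) * \<sigma>"
          unfolding j_def using not_less_Least[of i "\<lambda>j. dist x y \<le> 2 ^ (j + 1) * \<sigma>"] by simp
        then show ?thesis using Suc by simp
      qed
      have "dist x y < 2 ^ l" using l y P by auto
      also have "(2::real) ^ l = 2 ^ (k + l) * \<sigma>" using \<sigma>(2) by (simp add: power_add)
      finally have "2 ^ j * \<sigma> < 2 ^ (k + l) * \<sigma>" using lo by simp
      then have "j < k + l" using \<sigma>(1) by simp
      then show ?thesis using up lo y by (auto simp: A_def)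
    qed
    have "(\<Sum>y\<in>P - {x}. f y) \<le> (\<Sum>y\<in>P - {x}. \<Sum>j<k + l. if y \<in> A j then f y else 0)"
    proof (rule sum_mono)
      fix y assume "y \<in> P - {x}"
      then obtain j where j: "j < k + l" "y \<in> A j" using shell by blast
      have "(if y \<in> A j then f y else 0) \<le> (\<Sum>j<k + l. if y \<in> A j then f y else 0)"
        using j f0 by (intro member_le_sum) auto
      then show "f y \<le> (\<Sum>j<k + l. if y \<in> A j then f y else 0)" using j by simp
    qed
    also have "\<dots> = (\<Sum>j<k + l. \<Sum>y\<in>P - {x}. if y \<in> A j then f y else 0)" by (rule sum.swap)
    also have "\<dots> \<le> (\<Sum>j<k + l. 2 ^ m * (K * \<sigma> powr - D))"
    proof (rule sum_mono)
      fix j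
      \<comment> \<open>The outer radius of the shell; distances in it exceed \<open>R / 2\<close>,
        which costs the factor \<open>2 ^ m\<close>.\<close>
      define R where "R = 2 ^ (j + 1) * \<sigma>"
      have R: "\<sigma> < R"
      proof -
        have "(1::real) < 2 ^ (j + 1)" by (rule one_less_power) auto
        then show ?thesis using \<sigma>(1) by (simp add: R_def)
      qed
      have AP: "A j \<subseteq> P - {x}" "finite (A j)" using finP by (auto simp: A_def)
      have "(\<Sum>y\<in>P - {x}. if y \<in> A j then f y else 0) = (\<Sum>y\<in>A j. f y)"
        using AP finP by (simp add: sum.If_cases Int_absorb1)
      also have "\<dots> \<le> (\<Sum>y\<in>A j. (2 * \<sigma> / R) ^ m)"
      proof (rule sum_mono)
        fix y assume y: "y \<in> A j"
        then have *: "R / 2 < dist x y" by (simp add: A_def R_def)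
        have "\<sigma> / dist x y \<le> \<sigma> / (R / 2)"
          using * \<sigma> R by (intro divide_left_mono mult_pos_pos) auto
        then show "f y \<le> (2 * \<sigma> / R) ^ m"
          unfolding f_def using \<sigma> by (intro power_mono) (auto simp: mult.commute)
      qed
      also have "\<dots> = 2 ^ m * ((\<sigma> / R) ^ m * real (card (A j)))"
        by (simp add: power_mult_distrib power_divide)
      also have "\<dots> \<le> 2 ^ m * ((\<sigma> / R) ^ m * real (card (P \<inter> cball x R)))"
      proof -
        have "card (A j) \<le> card (P \<inter> cball x R)"
          using finP by (intro card_mono) (auto simp: A_def R_def)
        then show ?thesis using \<sigma> R by (intro mult_left_mono) auto
      qed
      also have "\<dots> \<le> 2 ^ m * (K * \<sigma> powr - D)"
        using K(3)[OF \<sigma>(1) _ R P(1) _ P(3)] k P(2) by (simp add: \<sigma>_def)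
      finally show "(\<Sum>y\<in>P - {x}. if y \<in> A j then f y else 0) \<le> 2 ^ m * (K * \<sigma> powr - D)" .
    qed
    also have "\<dots> = 2 ^ m * K * real (k + l) * \<sigma> powr - D" by simp
    finally show "(\<Sum>y\<in>P - {x}. ((1/2) ^ k / dist x y) ^ m) \<le> 2 ^ m * K * real (k + l) * ((1/2) ^ k) powr - D"
      by (simp add: f_def \<sigma>_def)
  qed
qed

section \<open>Counting pairs of points with close images\<close>

text \<open>Sort \<open>P\<close> by a chosen covering set of the image. Points in one class have
  images within \<open>r\<close>, and Cauchy-Schwarz over the classes compares the square of
  \<open>card P\<close> with the number of such pairs. The diagonal and coinciding images are
  counted too.\<close>

lemma card_squared_le_close_pairs:
  fixes f :: "'b \<Rightarrow> 'a::euclidean_space"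
  assumes "finite P" "bounded E" "f ` P \<subseteq> E" "0 < r"
  shows "(card P)\<^sup>2 \<le> covering_number r E * card {(x, y) \<in> P \<times> P. dist (f x) (f y) \<le> r}"
proof -
  obtain \<U> where \<U>: "finite \<U>" "card \<U> = covering_number r E"
    "\<And>U. U \<in> \<U> \<Longrightarrow> bounded U \<and> diameter U \<le> r" "E \<subseteq> \<Union>\<U>"
    using covering_number_obtains[OF assms(2,4)] by metis
  have "\<forall>p\<in>P. \<exists>U\<in>\<U>. f p \<in> U" using assms(3) \<U>(4) by blast
  then obtain g where g: "\<And>p. p \<in> P \<Longrightarrow> g p \<in> \<U> \<and> f p \<in> g p" by metis
  define Q where "Q U = {p \<in> P. g p = U}" for U
  have fQ: "finite (Q U)" for U using assms(1) by (simp add: Q_def)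
  have "card P = (\<Sum>U\<in>\<U>. card (Q U))"
  proof -
    have "P = (\<Union>U\<in>\<U>. Q U)" using g by (auto simp: Q_def)
    then show ?thesis
      using card_UN_disjoint[of \<U> Q] \<U>(1) fQ by (auto simp: Q_def)
  qed
  then have "(real (card P))\<^sup>2 = (\<Sum>U\<in>\<U>. real (card (Q U)))\<^sup>2" by simp
  also have "\<dots> \<le> (\<Sum>U\<in>\<U>. (real (card (Q U)))\<^sup>2) * card \<U>" by (rule sum_squared_le_sum_of_squares)
  also have "(\<Sum>U\<in>\<U>. (real (card (Q U)))\<^sup>2) = real (\<Sum>U\<in>\<U>. card (Q U \<times> Q U))"
    by (simp add: card_cartesian_product power2_eq_square)
  also have "(\<Sum>U\<in>\<U>. card (Q U \<times> Q U)) = card (\<Union>U\<in>\<U>. Q U \<times> Q U)"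
    using \<U>(1) fQ by (intro card_UN_disjoint[symmetric]) (auto simp: Q_def)
  also have "real (card (\<Union>U\<in>\<U>. Q U \<times> Q U)) \<le> real (card {(x, y) \<in> P \<times> P. dist (f x) (f y) \<le> r})"
  proof -
    have "dist (f x) (f y) \<le> r" if "x \<in> Q U" "y \<in> Q U" "U \<in> \<U>" for x y U
    proof -
      have "f x \<in> U" "f y \<in> U" using that g by (auto simp: Q_def)
      then have "dist (f x) (f y) \<le> diameter U" using \<U>(3)[OF that(3)] by (intro diameter_bounded_bound) auto
      then show ?thesis using \<U>(3)[OF that(3)] by linarith
    qed
    then have "(\<Union>U\<in>\<U>. Q U \<times> Q U) \<subseteq> {(x, y) \<in> P \<times> P. dist (f x) (f y) \<le> r}"
      by (auto simp: Q_def)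
    moreover have "finite {(x, y) \<in> P \<times> P. dist (f x) (f y) \<le> r}"
      by (rule finite_subset[OF _ finite_cartesian_product[OF assms(1) assms(1)]]) blast
    ultimately show ?thesis by (simp add: card_mono)
  qed
  finally have "(real (card P))\<^sup>2 \<le> real (card {(x, y) \<in> P \<times> P. dist (f x) (f y) \<le> r}) * real (card \<U>)"
    by (simp add: mult_right_mono)
  then have "real ((card P)\<^sup>2) \<le> real (card {(x, y) \<in> P \<times> P. dist (f x) (f y) \<le> r} * card \<U>)" by simp
  then show ?thesis using \<U>(2) by (simp only: of_nat_le_iff mult.commute)
qed

section \<open>Box dimensions of projections\<close>

lemma dyadic_scale:
  fixes r :: real
  assumes "0 < r" "r \<le> 1"
  obtains k :: nat where "(1/2) ^ (k + 1) < r" "r \<le> (1/2) ^ k"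
proof -
  obtain N where N: "(1/2) ^ N < r" using real_arch_pow_inv[OF assms(1), of "1/2"] by auto
  define j where "j = (LEAST j. (1/2) ^ j < r)"
  have j: "(1/2) ^ j < r" unfolding j_def by (rule LeastI[of "\<lambda>j. (1/2) ^ j < r", OF N])
  then have "j \<noteq> 0" using assms(2) by (intro notI) simp
  then obtain k where k: "j = k + 1" by (metis Suc_eq_plus1 not0_implies_Suc)
  have "\<not> (1/2) ^ k < r"
    using not_less_Least[of k "\<lambda>j. (1/2) ^ j < r"] k by (simp add: j_def)
  then show ?thesis using that[of k] j k by (simp add: not_less)
qed

lemma sum_indicator:
  "finite A \<Longrightarrow> (\<Sum>x\<in>A. indicator B x) = (of_nat (card (A \<inter> B)) :: 'a::semiring_1)"
  by (simp add: indicator_def sum.If_cases)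

text \<open>\<open>G k V\<close> counts the pairs in \<open>P k\<close> with projections within
  \<open>(1/2) ^ k\<close>. Its weighted expectations are summable because \<open>D < D'\<close>, so
  for almost every \<open>V\<close> all the weighted counts share one finite bound, which supplies a
  \<open>B\<close> depending on \<open>V\<close>.\<close>

lemma AE_projection_covering_number:
  fixes F :: "(real^'n) set" and \<gamma> :: "(real^'n) set measure"
  assumes inv: "invariant_grassmann_measure m \<gamma>" and F: "bounded F" "F \<noteq> {}"
    and \<theta>: "0 < \<theta>" "\<theta> < 1" and D: "Delta m \<theta> F < ereal D" and D': "D < D'"
  shows "AE V in \<gamma>. \<exists>B>0. \<forall>\<^sub>F r in at_right 0.
           real (covering_number r F) * r powr D' \<le> B * real (covering_number r (orth_proj V ` F))"
proof -
  interpret prob_space \<gamma> by (rule invariant_grassmann_measureD(1)[OF inv])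
  note sets = invariant_grassmann_measureD(2)[OF inv] and space = invariant_grassmann_measureD(3)[OF inv]
  have D0: "0 < D" using D by (simp add: Delta_def)
  obtain c where c: "c > 0" "\<And>x r. x \<noteq> 0 \<Longrightarrow> 0 \<le> r \<Longrightarrow>
    emeasure \<gamma> {V \<in> space \<gamma>. norm (orth_proj V x) \<le> r} \<le> ennreal (c * (r / norm x) ^ m)"
    by (rule projection_small_ball[OF inv]) (rule that, assumption, blast)
  obtain K \<sigma>\<^sub>0 :: real and l :: nat where K: "0 < K" "0 < \<sigma>\<^sub>0"
    "\<And>k P x. (1/2) ^ k \<le> \<sigma>\<^sub>0 \<Longrightarrow> P \<subseteq> F \<Longrightarrow> separated ((1/2) ^ k) P \<Longrightarrow> x \<in> P \<Longrightarrow>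
      (\<Sum>y\<in>P - {x}. ((1/2) ^ k / dist x y) ^ m) \<le> K * real (k + l) * ((1/2) ^ k) powr - D"
    using separated_energy_bound[OF F(1) \<theta> D] by metis
  have "\<exists>k. (1/2) ^ k < \<sigma>\<^sub>0" by (rule real_arch_pow_inv[OF K(2)]) simp
  then obtain k0 where k0: "(1/2) ^ k0 < \<sigma>\<^sub>0" by blast
  have small: "(1/2) ^ (k + 2) \<le> \<sigma>\<^sub>0" if "k0 \<le> k" for k
  proof -
    have "(1/2 :: real) ^ (k + 2) \<le> (1/2) ^ k0" using that by (intro power_decreasing) auto
    then show ?thesis using k0 by linarith
  qed
  have "\<exists>P. P \<subseteq> F \<and> finite P \<and> separated ((1/2) ^ (k + 2)) P \<and> covering_number ((1/2) ^ (k + 1)) F \<le> card P" for k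
  proof -
    have e: "2 * (1/2) ^ (k + 2) = ((1/2) ^ (k + 1) :: real)" by simp
    show ?thesis
      using maximal_separated_exists[OF F(1), of "(1/2) ^ (k + 2)"] unfolding e
      by (metis zero_less_divide_1_iff zero_less_numeral zero_less_power)
  qed
  \<comment> \<open>The points are separated at a quarter of the scale at which projections are compared, so that
    \<open>card (P k)\<close> still dominates the covering numbers of \<open>F\<close> for all \<open>r\<close> between \<open>(1/2) ^ (k + 1)\<close>
    and \<open>(1/2) ^ k\<close>.\<close>
  then obtain P where P: "\<And>k. P k \<subseteq> F" "\<And>k. finite (P k)" "\<And>k. separated ((1/2) ^ (k + 2)) (P k)"
    "\<And>k. covering_number ((1/2) ^ (k + 1)) F \<le> card (P k)"
    by metis
  have Ppos: "0 < card (P k)" for k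
    using covering_number_pos[OF F, of "(1/2) ^ (k + 1)"] P(4)[of k] by simp
  define A where "A z k = {V \<in> space \<gamma>. norm (orth_proj V z) \<le> (1/2) ^ k}" for z :: "real^'n" and k :: nat
  have A[measurable]: "A z k \<in> sets \<gamma>" for z k
    unfolding A_def by (rule measurable_orth_proj_le[OF sets])
  define G where "G k V = (\<Sum>x\<in>P k. \<Sum>y\<in>P k. indicator (A (x - y) k) V :: ennreal)" for k V
  have [measurable]: "G k \<in> borel_measurable \<gamma>" for k unfolding G_def by measurable
  \<comment> \<open>The 1 pays for the diagonal pair, \<open>4 ^ m\<close> and
    \<open>4 powr D\<close> for the separation being a quarter of the comparison scale, and
    \<open>real l + 2\<close> absorbs \<open>k + 2 + l\<close> into a multiple of
    \<open>Suc k\<close>.\<close>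
  define M where "M = 1 + c * 4 ^ m * K * (real l + 2) * 4 powr D"
  have M: "M > 0" using c K by (simp add: M_def add_pos_nonneg)
  have intG: "(\<integral>\<^sup>+V. G k V \<partial>\<gamma>) \<le> ennreal (real (card (P k)) * (M * real (Suc k) * 2 powr (real k * D)))"
    if k: "k0 \<le> k" for k
  proof -
    let ?b = "M * real (Suc k) * 2 powr (real k * D)"
    have "(\<Sum>y\<in>P k. emeasure \<gamma> (A (x - y) k)) \<le> ennreal ?b" if x: "x \<in> P k" for x
    proof -
      define s where "s = (\<Sum>y\<in>P k - {x}. ((1/2) ^ (k + 2) / dist x y) ^ m)"
      have s: "s \<le> K * real (k + 2 + l) * ((1/2) ^ (k + 2)) powr - D"
        unfolding s_def by (rule K(3)[OF small[OF k] P(1) P(3) x])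
      have "(\<Sum>y\<in>P k. emeasure \<gamma> (A (x - y) k))
          = emeasure \<gamma> (A (x - x) k) + (\<Sum>y\<in>P k - {x}. emeasure \<gamma> (A (x - y) k))"
        by (rule sum.remove[OF P(2) x])
      also have "\<dots> \<le> 1 + (\<Sum>y\<in>P k - {x}. ennreal (c * 4 ^ m * ((1/2) ^ (k + 2) / dist x y) ^ m))"
      proof (intro add_mono sum_mono)
        show "emeasure \<gamma> (A (x - x) k) \<le> 1" by (rule emeasure_le_1)
        fix y assume y: "y \<in> P k - {x}"
        have "emeasure \<gamma> (A (x - y) k) \<le> ennreal (c * ((1/2) ^ k / norm (x - y)) ^ m)"
          unfolding A_def using y by (intro c(2)) auto
        also have "(1/2) ^ k / norm (x - y) = 4 * ((1/2) ^ (k + 2) / dist x y)"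
          by (simp add: dist_norm power_add)
        also have "c * (4 * ((1/2) ^ (k + 2) / dist x y)) ^ m = c * 4 ^ m * ((1/2) ^ (k + 2) / dist x y) ^ m"
          by (simp only: power_mult_distrib mult.assoc)
        finally show "emeasure \<gamma> (A (x - y) k) \<le> ennreal (c * 4 ^ m * ((1/2) ^ (k + 2) / dist x y) ^ m)" .
      qed
      also have "\<dots> = 1 + ennreal (c * 4 ^ m * s)"
        using c by (subst sum_ennreal) (auto simp: s_def sum_distrib_left)
      also have "\<dots> = ennreal (1 + c * 4 ^ m * s)"
      proof -
        have "0 \<le> s" unfolding s_def by (intro sum_nonneg) auto
        then show ?thesis using c by (subst ennreal_plus) auto
      qed
      also have "\<dots> \<le> ennreal ?b"
      proof (rule ennreal_leI)
        have e: "((1/2) ^ (k + 2)) powr - D = 4 powr D * 2 powr (real k * D)"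
        proof -
          have "((1/2::real) ^ (k + 2)) powr - D = (2 ^ (k + 2)) powr D"
            by (simp add: powr_minus powr_divide power_divide)
          also have "\<dots> = (4 * 2 powr real k) powr D" by (simp add: power_add powr_realpow)
          also have "\<dots> = 4 powr D * 2 powr (real k * D)" by (simp add: powr_mult powr_powr)
          finally show ?thesis .
        qed
        define u where "u = 2 powr (real k * D)"
        have u: "1 \<le> u" using D0 by (simp add: u_def ge_one_powr_ge_zero)
        have "s \<le> K * (real l + 2) * real (Suc k) * (4 powr D * u)"
        proof -
          have "real (k + 2 + l) \<le> (real l + 2) * real (Suc k)" by (simp add: algebra_simps)
          then have "K * real (k + 2 + l) \<le> K * ((real l + 2) * real (Suc k))" using K by (intro mult_left_mono) auto
          then have "K * real (k + 2 + l) * (4 powr D * u) \<le> K * ((real l + 2) * real (Suc k)) * (4 powr D * u)"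
            using u by (intro mult_right_mono) auto
          then show ?thesis using s unfolding e u_def by (simp add: mult.assoc)
        qed
        then have "c * 4 ^ m * s \<le> c * 4 ^ m * (K * (real l + 2) * real (Suc k) * (4 powr D * u))"
          using c by (intro mult_left_mono) auto
        moreover have "1 \<le> real (Suc k) * u" using u mult_mono[of 1 "real (Suc k)" 1 u] by simp
        ultimately have "1 + c * 4 ^ m * s \<le> real (Suc k) * u + c * 4 ^ m * (K * (real l + 2) * real (Suc k) * (4 powr D * u))"
          by linarith
        also have "\<dots> = M * real (Suc k) * u" by (simp only: M_def) algebra
        finally show "1 + c * 4 ^ m * s \<le> ?b" by (simp add: u_def)
      qed
      finally show ?thesis .
    qed
    then have "(\<Sum>x\<in>P k. \<Sum>y\<in>P k. emeasure \<gamma> (A (x - y) k)) \<le> (\<Sum>x\<in>P k. ennreal ?b)"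
      by (rule sum_mono)
    also have "\<dots> = ennreal (real (card (P k)) * ?b)" by (simp add: ennreal_mult' ennreal_of_nat_eq_real_of_nat)
    also have "(\<Sum>x\<in>P k. \<Sum>y\<in>P k. emeasure \<gamma> (A (x - y) k)) = (\<integral>\<^sup>+V. G k V \<partial>\<gamma>)"
      by (simp add: G_def nn_integral_sum)
    finally show ?thesis .
  qed
  \<comment> \<open>Dividing by \<open>card (P k)\<close> normalises to one point, and
    \<open>2 powr - (real k * D')\<close> beats the growth \<open>2 powr (real k * D)\<close>,
    leaving the geometric ratio \<open>z\<close> below.\<close>
  define w where "w k = 2 powr - (real k * D') / real (card (P k))" for k
  have w0: "0 \<le> w k" for k by (simp add: w_def)
  define z where "z = 2 powr (D - D')"
  have z: "0 < z" "z < 1" using D' by (simp_all add: z_def powr_less_one)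
  \<comment> \<open>The sum starts at \<open>k0\<close>, from where the energy bound
    applies.\<close>
  define H where "H V = (\<Sum>k. ennreal (w (k + k0)) * G (k + k0) V)" for V
  have "(\<integral>\<^sup>+V. H V \<partial>\<gamma>) = (\<Sum>k. \<integral>\<^sup>+V. ennreal (w (k + k0)) * G (k + k0) V \<partial>\<gamma>)"
    unfolding H_def by (rule nn_integral_suminf) measurable
  also have "\<dots> \<le> (\<Sum>k. ennreal (M * (real (Suc (k + k0)) * z ^ (k + k0))))"
  proof (rule suminf_le)
    fix k
    define j where "j = k + k0"
    have "(\<integral>\<^sup>+V. ennreal (w j) * G j V \<partial>\<gamma>) = ennreal (w j) * (\<integral>\<^sup>+V. G j V \<partial>\<gamma>)"
      by (rule nn_integral_cmult) measurable
    also have "\<dots> \<le> ennreal (w j) * ennreal (real (card (P j)) * (M * real (Suc j) * 2 powr (real j * D)))"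
      by (intro mult_left_mono intG) (auto simp: j_def)
    also have "\<dots> = ennreal (w j * (real (card (P j)) * (M * real (Suc j) * 2 powr (real j * D))))"
      using w0 by (rule ennreal_mult'[symmetric])
    also have "w j * (real (card (P j)) * (M * real (Suc j) * 2 powr (real j * D)))
        = M * (real (Suc j) * (2 powr - (real j * D') * 2 powr (real j * D)))"
      using Ppos[of j] by (simp add: w_def)
    also have "2 powr - (real j * D') * 2 powr (real j * D) = z ^ j"
      by (simp add: z_def powr_add[symmetric] powr_powr powr_realpow[symmetric] algebra_simps)
    finally show "(\<integral>\<^sup>+V. ennreal (w (k + k0)) * G (k + k0) V \<partial>\<gamma>) \<le> ennreal (M * (real (Suc (k + k0)) * z ^ (k + k0)))"
      by (simp add: j_def)
  qed auto
  also have "\<dots> < \<infinity>"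
  proof -
    have "summable (\<lambda>k. real (Suc k) * z ^ k)"
      using geometric_deriv_sums[of z] z by (auto simp: sums_iff)
    then have "summable (\<lambda>k. M * (real (Suc (k + k0)) * z ^ (k + k0)))"
      by (intro summable_mult) (subst summable_iff_shift[of "\<lambda>k. real (Suc k) * z ^ k"])
    then have "(\<Sum>k. ennreal (M * (real (Suc (k + k0)) * z ^ (k + k0)))) \<noteq> top"
      using M z by (intro ennreal_suminf_neq_top) auto
    then show ?thesis by (simp add: less_top)
  qed
  finally have "(\<integral>\<^sup>+V. H V \<partial>\<gamma>) \<noteq> \<infinity>" by simp
  then have "AE V in \<gamma>. H V \<noteq> \<infinity>"
    unfolding H_def by (intro nn_integral_noteq_infinite) auto
  then show ?thesis
  proof (rule AE_mp, intro AE_I2 impI)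
    fix V assume V: "V \<in> space \<gamma>" and H: "H V \<noteq> \<infinity>"
    have sub: "subspace V" using V by (simp add: space grassmannian_def)
    have bdd: "bounded (orth_proj V ` F)"
      using F(1) linear_orth_proj[OF sub] by (intro bounded_linear_image) (auto simp: linear_conv_bounded_linear)
    \<comment> \<open>Adding 1 keeps \<open>B\<close> positive even when \<open>H V\<close>
      vanishes.\<close>
    define B where "B = enn2real (H V) + 1"
    have B: "B > 0" by (simp add: B_def add_nonneg_pos)
    have main: "real (card (P k)) * 2 powr - (real k * D') \<le> B * real (covering_number ((1/2) ^ k) (orth_proj V ` F))"
      if k: "k0 \<le> k" for k
    proof -
      define q where "q = card {(x, y) \<in> P k \<times> P k. dist (orth_proj V x) (orth_proj V y) \<le> (1/2) ^ k}"
      have "G k V = of_nat q"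
      proof -
        have "G k V = (\<Sum>p\<in>P k \<times> P k. indicator (A (fst p - snd p) k) V)"
          unfolding G_def by (simp add: sum.cartesian_product split_beta)
        also have "\<dots> = (\<Sum>p\<in>P k \<times> P k. indicator {(x, y) \<in> P k \<times> P k. dist (orth_proj V x) (orth_proj V y) \<le> (1/2) ^ k} p)"
          using V by (intro sum.cong)
            (auto simp: indicator_def A_def dist_norm linear_diff[OF linear_orth_proj[OF sub]])
        also have "\<dots> = of_nat (card ((P k \<times> P k) \<inter> {(x, y) \<in> P k \<times> P k. dist (orth_proj V x) (orth_proj V y) \<le> (1/2) ^ k}))"
          by (rule sum_indicator) (simp add: P(2))
        also have "(P k \<times> P k) \<inter> {(x, y) \<in> P k \<times> P k. dist (orth_proj V x) (orth_proj V y) \<le> (1/2) ^ k}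
          = {(x, y) \<in> P k \<times> P k. dist (orth_proj V x) (orth_proj V y) \<le> (1/2) ^ k}" by blast
        finally show ?thesis by (simp add: q_def)
      qed
      moreover have "ennreal (w k) * G k V \<le> H V"
      proof -
        have "(\<Sum>i\<in>{k - k0}. ennreal (w (i + k0)) * G (i + k0) V) \<le> H V"
          unfolding H_def by (intro sum_le_suminf) auto
        then show ?thesis using k by simp
      qed
      ultimately have "ennreal (w k * real q) \<le> H V"
        using w0 by (simp add: ennreal_mult' ennreal_of_nat_eq_real_of_nat)
      also have "\<dots> \<le> ennreal B"
        using H by (cases "H V") (auto simp: B_def)
      finally have wq: "w k * real q \<le> B" using B by (simp add: ennreal_le_iff)
      let ?N = "covering_number ((1/2) ^ k) (orth_proj V ` F)"
      \<comment> \<open>After multiplication by \<open>w k\<close>, one factor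
        \<open>card (P k)\<close> cancels and the bound on \<open>w k * real q\<close> leaves the
        claim.\<close>
      have "(card (P k))\<^sup>2 \<le> ?N * q"
        unfolding q_def using P(1)[of k] by (intro card_squared_le_close_pairs P(2) bdd image_mono) auto
      then have "(real (card (P k)))\<^sup>2 \<le> real ?N * real q"
        by (metis of_nat_le_iff of_nat_mult of_nat_power)
      then have "w k * (real (card (P k)))\<^sup>2 \<le> w k * (real ?N * real q)"
        by (intro mult_left_mono w0)
      also have "\<dots> = real ?N * (w k * real q)" by simp
      also have "\<dots> \<le> real ?N * B" using wq by (intro mult_left_mono) auto
      finally show ?thesis using Ppos[of k] by (simp add: w_def power2_eq_square mult.commute)
    qed
    have "\<forall>\<^sub>F r in at_right 0. r \<in> {0 <..< (1/2 :: real) ^ k0}"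
      by (rule eventually_at_right_real) auto
    then have "\<forall>\<^sub>F r in at_right 0.
           real (covering_number r F) * r powr D' \<le> B * real (covering_number r (orth_proj V ` F))"
    proof eventually_elim
      case (elim r)
      have "(1/2 :: real) ^ k0 \<le> 1" by (rule power_le_one) auto
      then obtain k where k: "(1/2) ^ (k + 1) < r" "r \<le> (1/2) ^ k"
        using dyadic_scale[of r] elim by auto
      have kk: "k0 \<le> k"
      proof (rule ccontr)
        assume "\<not> k0 \<le> k"
        then have "(1/2 :: real) ^ k0 \<le> (1/2) ^ (k + 1)" by (intro power_decreasing) auto
        then show False using k elim by auto
      qed
      have "covering_number r F \<le> card (P k)"
        using covering_number_mono[OF F(1) order_refl, of "(1/2) ^ (k + 1)" r] k P(4)[of k] by simp
      moreover have "r powr D' \<le> 2 powr - (real k * D')"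
      proof -
        have "r powr D' \<le> ((1/2) ^ k) powr D'" using k elim D0 D' by (intro powr_mono2) auto
        also have "(1/2) ^ k = (2::real) powr - real k"
          by (simp add: powr_minus_divide powr_realpow power_divide)
        also have "(2 powr - real k) powr D' = 2 powr - (real k * D')" by (simp add: powr_powr)
        finally show ?thesis .
      qed
      ultimately have "real (covering_number r F) * r powr D' \<le> real (card (P k)) * 2 powr - (real k * D')"
        by (intro mult_mono) auto
      also have "\<dots> \<le> B * real (covering_number ((1/2) ^ k) (orth_proj V ` F))" by (rule main[OF kk])
      also have "\<dots> \<le> B * real (covering_number r (orth_proj V ` F))"
      proof -
        have "covering_number ((1/2) ^ k) (orth_proj V ` F) \<le> covering_number r (orth_proj V ` F)"
          using k elim by (intro covering_number_mono bdd) auto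
        then show ?thesis using B by (intro mult_left_mono) auto
      qed
      finally show ?case .
    qed
    then show "\<exists>B>0. \<forall>\<^sub>F r in at_right 0.
           real (covering_number r F) * r powr D' \<le> B * real (covering_number r (orth_proj V ` F))"
      using B by blast
  qed
qed

section \<open>From covering numbers to box dimensions\<close>

text \<open>Under logarithms the constant \<open>B\<close> becomes an additive term, absorbed at
  small \<open>r\<close> by a gap in the exponent. Comparing the ratios pointwise in
  \<open>r\<close> serves upper and lower limits alike.\<close>

lemma AE_box_ratio_projection:
  fixes F :: "(real^'n) set" and \<gamma> :: "(real^'n) set measure"
  assumes inv: "invariant_grassmann_measure m \<gamma>" and F: "bounded F" "F \<noteq> {}"
    and \<theta>: "0 < \<theta>" "\<theta> < 1" and D: "Delta m \<theta> F < ereal D"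
  shows "AE V in \<gamma>. \<forall>\<^sub>F r in at_right 0.
           ereal (ln (real (covering_number r F)) / - ln r)
           \<le> ereal (ln (real (covering_number r (orth_proj V ` F))) / - ln r) + ereal D"
proof -
  \<comment> \<open>The room below \<open>D\<close> is spent twice: from \<open>D1\<close> to
    \<open>D2\<close> for summability over scales, from \<open>D2\<close> to \<open>D\<close> for
    the constant \<open>B\<close>.\<close>
  obtain D1 where D1: "Delta m \<theta> F < ereal D1" "D1 < D" using ereal_dense2[OF D] by auto
  define D2 where "D2 = (D1 + D) / 2"
  have D2: "D1 < D2" "D2 < D" using D1(2) by (auto simp: D2_def)
  note space = invariant_grassmann_measureD(3)[OF inv]
  show ?thesis
    using AE_projection_covering_number[OF inv F \<theta> D1(1) D2(1)]
  proof (rule AE_mp, intro AE_I2 impI)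
    fix V assume V: "V \<in> space \<gamma>" and "\<exists>B>0. \<forall>\<^sub>F r in at_right 0.
           real (covering_number r F) * r powr D2 \<le> B * real (covering_number r (orth_proj V ` F))"
    then obtain B where B: "B > 0" and ev: "\<forall>\<^sub>F r in at_right 0.
           real (covering_number r F) * r powr D2 \<le> B * real (covering_number r (orth_proj V ` F))"
      by blast
    have "subspace V" using V by (simp add: space grassmannian_def)
    then have bdd: "bounded (orth_proj V ` F)"
      using F(1) linear_orth_proj by (intro bounded_linear_image) (auto simp: linear_conv_bounded_linear)
    \<comment> \<open>Once \<open>- ln r\<close> exceeds \<open>t\<close>, the gap
      \<open>D - D2\<close> outweighs \<open>ln B\<close>. The extra 1 in the threshold
      \<open>exp (- t - 1)\<close> makes \<open>ln r\<close> negative even for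
      \<open>t = 0\<close>.\<close>
    define t where "t = \<bar>ln B\<bar> / (D - D2)"
    have t: "0 \<le> t" using D2 by (simp add: t_def)
    have "\<forall>\<^sub>F r in at_right 0. r \<in> {0 <..< exp (- t - 1)}"
      by (rule eventually_at_right_real) auto
    with ev show "\<forall>\<^sub>F r in at_right 0.
           ereal (ln (real (covering_number r F)) / - ln r)
           \<le> ereal (ln (real (covering_number r (orth_proj V ` F))) / - ln r) + ereal D"
    proof eventually_elim
      case (elim r)
      then have r: "0 < r" "ln r < - t - 1"
        using ln_less_cancel_iff[of r "exp (- t - 1)"] by auto
      have "ln r < 0" using r(2) t by linarith
      then have r1: "r < 1" using r(1) by simp
      have N: "1 \<le> real (covering_number r F)" "1 \<le> real (covering_number r (orth_proj V ` F))"
        using covering_number_pos[OF F r(1)] covering_number_pos[OF bdd _ r(1)] F(2) by auto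
      have "ln (real (covering_number r F) * r powr D2) \<le> ln (B * real (covering_number r (orth_proj V ` F)))"
        using elim(1) N r B by (subst ln_le_cancel_iff) auto
      then have *: "ln (real (covering_number r F)) + D2 * ln r \<le> ln B + ln (real (covering_number r (orth_proj V ` F)))"
        using N r B by (simp add: ln_mult ln_powr)
      have "ln B \<le> (D - D2) * t" using D2 by (simp add: t_def)
      also have "\<dots> \<le> (D - D2) * - ln r" using D2 r by (intro mult_left_mono) auto
      finally have "ln (real (covering_number r F)) \<le> ln (real (covering_number r (orth_proj V ` F))) + D * - ln r"
        using * by (simp add: algebra_simps)
      then have "ln (real (covering_number r F)) / - ln r
          \<le> (ln (real (covering_number r (orth_proj V ` F))) + D * - ln r) / - ln r"
        using r r1 by (intro divide_right_mono) auto
      also have "\<dots> = ln (real (covering_number r (orth_proj V ` F))) / - ln r + D"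
        using r r1 by (simp add: field_simps)
      finally show ?case by simp
    qed
  qed
qed

text \<open>The preceding bound holds for each \<open>D\<close> above \<open>Delta\<close> off a
  null set depending on \<open>D\<close>. The sequence \<open>\<delta> + 1 / real (Suc n)\<close>
  reduces these to a single null set before limits are taken.\<close>

lemma AE_box_dim_projection:
  fixes F :: "(real^'n) set" and \<gamma> :: "(real^'n) set measure"
  assumes inv: "invariant_grassmann_measure m \<gamma>" and F: "bounded F" "F \<noteq> {}"
    and \<theta>: "0 < \<theta>" "\<theta> < 1"
  shows "AE V in \<gamma>. upper_box_dim F - Delta m \<theta> F \<le> upper_box_dim (orth_proj V ` F) \<and>
                    lower_box_dim F - Delta m \<theta> F \<le> lower_box_dim (orth_proj V ` F)"
proof -
  obtain \<delta> where \<delta>: "Delta m \<theta> F = ereal \<delta>" using Delta_finite[OF \<theta>(2)] .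
  define f where "f r = ereal (ln (real (covering_number r F)) / - ln r)" for r
  define g where "g V = (\<lambda>r. ereal (ln (real (covering_number r (orth_proj V ` F))) / - ln r))" for V
  have "AE V in \<gamma>. \<forall>n::nat. \<forall>\<^sub>F r in at_right 0. f r \<le> g V r + ereal (\<delta> + 1 / real (Suc n))"
    unfolding AE_all_countable f_def g_def
    by (intro allI AE_box_ratio_projection[OF inv F \<theta>]) (simp add: \<delta>)
  then show ?thesis
  proof (rule AE_mp, intro AE_I2 impI)
    fix V assume ev: "\<forall>n::nat. \<forall>\<^sub>F r in at_right 0. f r \<le> g V r + ereal (\<delta> + 1 / real (Suc n))"
    have approx: "x \<le> y + ereal \<delta>" if "\<And>n. x \<le> y + ereal (\<delta> + 1 / real (Suc n))" for x y
    proof (rule ereal_le_epsilon2)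
      fix e :: real assume "0 < e"
      then obtain n where "1 / real (Suc n) < e" using nat_approx_posE by blast
      then have "y + ereal (\<delta> + 1 / real (Suc n)) \<le> y + ereal \<delta> + ereal e"
        by (cases y) auto
      then show "x \<le> y + ereal \<delta> + ereal e" using that[of n] by (rule order_trans[rotated])
    qed
    have minus: "x - ereal \<delta> \<le> y" if "x \<le> y + ereal \<delta>" for x y
      using that by (cases x; cases y) auto
    have "upper_box_dim F \<le> upper_box_dim (orth_proj V ` F) + ereal (\<delta> + 1 / real (Suc n))" for n
    proof -
      have "upper_box_dim F \<le> Limsup (at_right 0) (\<lambda>r. g V r + ereal (\<delta> + 1 / real (Suc n)))"
        unfolding upper_box_dim_def f_def[symmetric] using ev by (intro Limsup_mono) blast
      also have "\<dots> = Limsup (at_right 0) (g V) + ereal (\<delta> + 1 / real (Suc n))"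
        by (rule Limsup_add_ereal_right) auto
      finally show ?thesis unfolding upper_box_dim_def g_def .
    qed
    moreover have "lower_box_dim F \<le> lower_box_dim (orth_proj V ` F) + ereal (\<delta> + 1 / real (Suc n))" for n
    proof -
      have "lower_box_dim F \<le> Liminf (at_right 0) (\<lambda>r. g V r + ereal (\<delta> + 1 / real (Suc n)))"
        unfolding lower_box_dim_def f_def[symmetric] using ev by (intro Liminf_mono) blast
      also have "\<dots> = Liminf (at_right 0) (g V) + ereal (\<delta> + 1 / real (Suc n))"
        by (rule Liminf_add_ereal_right) auto
      finally show ?thesis unfolding lower_box_dim_def g_def .
    qed
    ultimately show "upper_box_dim F - Delta m \<theta> F \<le> upper_box_dim (orth_proj V ` F) \<and>
                    lower_box_dim F - Delta m \<theta> F \<le> lower_box_dim (orth_proj V ` F)"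
      unfolding \<delta> by (intro conjI minus approx)
  qed
qed

section \<open>Packing dimension\<close>

lemma upper_box_dim_leI:
  fixes A :: "'a::euclidean_space set" and B :: "'b::euclidean_space set"
  assumes "bounded A" "A \<noteq> {}" "\<And>r. 0 < r \<Longrightarrow> covering_number r A \<le> covering_number r B"
  shows "upper_box_dim A \<le> upper_box_dim B"
  unfolding upper_box_dim_def
proof (rule Limsup_mono)
  have "\<forall>\<^sub>F r in at_right 0. r \<in> {0 <..< 1 :: real}"
    by (rule eventually_at_right_real) auto
  then show "\<forall>\<^sub>F r in at_right 0. ereal (ln (real (covering_number r A)) / - ln r)
      \<le> ereal (ln (real (covering_number r B)) / - ln r)"
  proof eventually_elim
    case (elim r)
    then have "1 \<le> covering_number r A" using covering_number_pos assms by auto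
    then have "ln (real (covering_number r A)) \<le> ln (real (covering_number r B))"
      using assms(3)[of r] elim by (subst ln_le_cancel_iff) auto
    then show ?case using elim by (auto intro!: divide_right_mono_neg)
  qed
qed

lemma upper_box_dim_mono:
  fixes A B :: "'a::euclidean_space set"
  assumes "bounded B" "A \<subseteq> B" "A \<noteq> {}"
  shows "upper_box_dim A \<le> upper_box_dim B"
  using assms by (intro upper_box_dim_leI covering_number_mono) (auto intro: bounded_subset)

section \<open>Monotonicity and countable stability of the packing dimension\<close>

lemma packing_dim_mono: "A \<subseteq> B \<Longrightarrow> packing_dim A \<le> packing_dim B"
  unfolding packing_dim_def by (rule Inf_superset_mono) blast

text \<open>The constant sequence \<open>closure A\<close> is an admissible compact cover, and
  closing does not raise covering numbers.\<close>

lemma packing_dim_le_upper_box_dim: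
  fixes A :: "'a::euclidean_space set"
  assumes "bounded A" "A \<noteq> {}"
  shows "packing_dim A \<le> upper_box_dim A"
proof -
  have "packing_dim A \<le> (SUP j::nat. upper_box_dim (closure A))"
    unfolding packing_dim_def using assms closure_subset[of A]
    by (intro Inf_lower CollectI exI[of _ "\<lambda>j. closure A"] conjI refl) auto
  also have "\<dots> \<le> upper_box_dim A"
    using assms by (simp, intro upper_box_dim_leI covering_number_closure_le) auto
  finally show ?thesis .
qed

text \<open>Nearly optimal covers of the pieces are merged into one sequence by a pairing function.
  The detour through \<open>t\<close> above \<open>s\<close> is there because the infimum need not
  be attained.\<close>

lemma packing_dim_UN_le:
  fixes A :: "nat \<Rightarrow> 'a::euclidean_space set"
  assumes "\<And>i. packing_dim (A i) \<le> s"
  shows "packing_dim (\<Union>i. A i) \<le> s"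
proof (rule dense_ge)
  fix t assume "s < t"
  then have "packing_dim (A i) < t" for i using assms order_le_less_trans by blast
  have "\<forall>i. \<exists>K :: nat \<Rightarrow> 'a set. (\<forall>j. compact (K j) \<and> K j \<noteq> {}) \<and> A i \<subseteq> (\<Union>j. K j) \<and>
      (SUP j. upper_box_dim (K j)) < t"
  proof
    fix i
    have "packing_dim (A i) < t" using assms \<open>s < t\<close> order_le_less_trans by blast
    then obtain v where "v \<in> {(SUP j. upper_box_dim (K j)) | K :: nat \<Rightarrow> 'a set.
        (\<forall>j. compact (K j) \<and> K j \<noteq> {}) \<and> A i \<subseteq> (\<Union>j. K j)}" and v: "v < t"
      unfolding packing_dim_def Inf_less_iff by (elim bexE)
    then obtain K :: "nat \<Rightarrow> 'a set" where "v = (SUP j. upper_box_dim (K j))"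
      "\<forall>j. compact (K j) \<and> K j \<noteq> {}" "A i \<subseteq> (\<Union>j. K j)"
      by (elim CollectE exE conjE) (rule that)
    then show "\<exists>K :: nat \<Rightarrow> 'a set. (\<forall>j. compact (K j) \<and> K j \<noteq> {}) \<and> A i \<subseteq> (\<Union>j. K j) \<and>
      (SUP j. upper_box_dim (K j)) < t"
      using v by (intro exI[of _ K] conjI) simp_all
  qed
  then obtain K :: "nat \<Rightarrow> nat \<Rightarrow> 'a set"
    where "\<forall>i. (\<forall>j. compact (K i j) \<and> K i j \<noteq> {}) \<and> A i \<subseteq> (\<Union>j. K i j) \<and> (SUP j. upper_box_dim (K i j)) < t"
    by (rule choice[THEN exE])
  then have K: "\<And>i j. compact (K i j) \<and> K i j \<noteq> {}" "\<And>i. A i \<subseteq> (\<Union>j. K i j)"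
    "\<And>i. (SUP j. upper_box_dim (K i j)) < t" by simp_all
  define K' where "K' n = K (fst (prod_decode n)) (snd (prod_decode n))" for n
  have "(\<Union>i. A i) \<subseteq> (\<Union>n. K' n)"
  proof
    fix x assume "x \<in> (\<Union>i. A i)"
    then obtain i j where "x \<in> K i j" using K(2) by blast
    then have "x \<in> K' (prod_encode (i, j))" by (simp add: K'_def)
    then show "x \<in> (\<Union>n. K' n)" by blast
  qed
  then have "packing_dim (\<Union>i. A i) \<le> (SUP n. upper_box_dim (K' n))"
    unfolding packing_dim_def by (intro Inf_lower CollectI exI[of _ K'] conjI refl) (simp_all add: K'_def K(1))
  also have "\<dots> \<le> t"
  proof (rule SUP_least)
    fix n
    have "upper_box_dim (K' n) \<le> (SUP j. upper_box_dim (K (fst (prod_decode n)) j))"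
      unfolding K'_def by (rule SUP_upper) simp
    then show "upper_box_dim (K' n) \<le> t" using K(3)[of "fst (prod_decode n)"] by simp
  qed
  finally show "packing_dim (\<Union>i. A i) \<le> t" .
qed

lemma packing_dim_countable_UN_le:
  fixes A :: "'b \<Rightarrow> 'a::euclidean_space set"
  assumes "countable I" "I \<noteq> {}" "\<And>i. i \<in> I \<Longrightarrow> packing_dim (A i) \<le> s"
  shows "packing_dim (\<Union>i\<in>I. A i) \<le> s"
proof -
  have "(\<Union>i\<in>I. A i) = (\<Union>n. A (from_nat_into I n))"
    using range_from_nat_into[OF assms(2,1)] by (metis image_image)
  then show ?thesis
    using packing_dim_UN_le[of "\<lambda>n. A (from_nat_into I n)"] assms(2,3) from_nat_into by metis
qed

section \<open>Analytic sets\<close>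

text \<open>For Polish \<open>'a\<close> these are the classical Suslin sets. Real sequences serve
  as parameter space in place of Baire space, so that witnesses can be tagged and interleaved by
  coordinates.\<close>

definition analytic_set :: "'a::topological_space set \<Rightarrow> bool" where
  "analytic_set A \<longleftrightarrow> (\<exists>C :: ('a \<times> (nat \<Rightarrow> real)) set. closed C \<and> A = fst ` C)"

lemma continuous_on_snd_apply:
  "continuous_on UNIV (\<lambda>p :: 'a::topological_space \<times> (nat \<Rightarrow> real). snd p i)"
  by (rule continuous_on_compose2[OF continuous_on_product_coordinates continuous_on_snd[OF continuous_on_id]]) auto

text \<open>Selecting coordinates is continuous for the product topology, so one sequence can carry
  several witnesses.\<close>

lemma closed_reindex:
  fixes C :: "('a::topological_space \<times> (nat \<Rightarrow> real)) set" and h :: "nat \<Rightarrow> nat"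
  assumes "closed C"
  shows "closed {p. (fst p, \<lambda>i. snd p (h i)) \<in> C}"
proof -
  have "continuous_on UNIV (\<lambda>p :: 'a \<times> (nat \<Rightarrow> real). (fst p, \<lambda>i. snd p (h i)))"
    by (intro continuous_on_Pair continuous_on_fst continuous_on_id
        continuous_on_coordinatewise_then_product continuous_on_snd_apply)
  from closed_vimage[OF assms this] show ?thesis by (simp add: vimage_def)
qed

lemma closed_imp_analytic_set: "closed A \<Longrightarrow> analytic_set A"
  unfolding analytic_set_def by (intro exI[of _ "A \<times> UNIV"]) (auto simp: closed_Times)

lemma open_imp_analytic_set:
  fixes A :: "'a::metric_space set"
  assumes "open A"
  shows "analytic_set A"
\<comment> \<open>\<open>infdist\<close> to the empty set is 0 by convention, so the whole space is
  treated as a closed set instead.\<close>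
proof (cases "A = UNIV")
  case False
  \<comment> \<open>The extra coordinate bounds the inverse distance to the complement.\<close>
  define C where "C = {p :: 'a \<times> (nat \<Rightarrow> real). 1 \<le> snd p 0 * infdist (fst p) (- A)}"
  have "closed C"
    unfolding C_def by (intro closed_Collect_le continuous_intros continuous_on_snd_apply)
  moreover have "A = fst ` C"
  proof
    show "fst ` C \<subseteq> A"
    proof
      fix y assume "y \<in> fst ` C"
      then obtain x where "1 \<le> x 0 * infdist y (- A)" by (auto simp: C_def)
      then have "infdist y (- A) \<noteq> 0" by auto
      then show "y \<in> A" using infdist_zero[of y "- A"] by blast
    qed
    show "A \<subseteq> fst ` C"
    proof
      fix y assume y: "y \<in> A"
      then have "infdist y (- A) \<noteq> 0"
        using in_closed_iff_infdist_zero[of "- A" y] assms False by auto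
      then have "(y, \<lambda>i. 1 / infdist y (- A)) \<in> C" by (simp add: C_def)
      then show "y \<in> fst ` C" by (metis fst_conv imageI)
    qed
  qed
  ultimately show ?thesis unfolding analytic_set_def by blast
qed (simp add: closed_imp_analytic_set)

lemma analytic_set_UN:
  fixes A :: "nat \<Rightarrow> 'a::topological_space set"
  assumes "\<And>k. analytic_set (A k)"
  shows "analytic_set (\<Union>k. A k)"
proof -
  obtain C :: "nat \<Rightarrow> ('a \<times> (nat \<Rightarrow> real)) set"
    where C: "\<And>k. closed (C k)" "\<And>k. A k = fst ` C k"
    using assms unfolding analytic_set_def by metis
  define E where "E k = {p :: 'a \<times> (nat \<Rightarrow> real). snd p 0 = real k \<and> (fst p, \<lambda>i. snd p (Suc i)) \<in> C k}" for k
  have E: "closed (E k)" for k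
    unfolding E_def
    by (intro closed_Collect_conj closed_reindex C closed_Collect_eq continuous_on_snd_apply continuous_on_const)
  \<comment> \<open>Membership in \<open>E k\<close> pins the zeroth coordinate to \<open>k\<close>, so the union is locally finite.\<close>
  have "(\<Union>k. E k) = (\<Inter>n. (\<Union>k\<le>n. E k) \<union> {p. real n + 1 \<le> snd p 0})"
  proof (intro equalityI subsetI)
    fix p assume "p \<in> (\<Union>k. E k)"
    then obtain k where k: "p \<in> E k" by blast
    have "p \<in> (\<Union>k\<le>n. E k) \<union> {p. real n + 1 \<le> snd p 0}" for n
    proof (cases "k \<le> n")
      case False
      then have "real n + 1 \<le> real k" by linarith
      then show ?thesis using k by (simp add: E_def)
    qed (use k in blast)
    then show "p \<in> (\<Inter>n. (\<Union>k\<le>n. E k) \<union> {p. real n + 1 \<le> snd p 0})" by blast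
  next
    fix p assume p: "p \<in> (\<Inter>n. (\<Union>k\<le>n. E k) \<union> {p. real n + 1 \<le> snd p 0})"
    obtain n where "snd p 0 < real n" using reals_Archimedean2 by blast
    then have "\<not> real n + 1 \<le> snd p 0" by linarith
    then show "p \<in> (\<Union>k. E k)" using p by blast
  qed
  also have "closed \<dots>"
    by (intro closed_INT ballI closed_Un closed_UN E closed_Collect_le continuous_on_snd_apply continuous_on_const) auto
  finally have "closed (\<Union>k. E k)" .
  moreover have "(\<Union>k. A k) = fst ` (\<Union>k. E k)"
  proof (intro equalityI subsetI)
    fix y assume "y \<in> (\<Union>k. A k)"
    then obtain k x where "(y, x) \<in> C k" using C(2) by force
    then have "(y, case_nat (real k) x) \<in> E k" by (simp add: E_def)
    then show "y \<in> fst ` (\<Union>k. E k)" by force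
  next
    fix y assume "y \<in> fst ` (\<Union>k. E k)"
    then show "y \<in> (\<Union>k. A k)" using C(2) by (force simp: E_def)
  qed
  ultimately show ?thesis unfolding analytic_set_def by blast
qed

text \<open>One sequence encodes witnesses for all \<open>k\<close> through the pairing function,
  and an intersection of closed conditions is closed.\<close>

lemma analytic_set_INT:
  fixes A :: "nat \<Rightarrow> 'a::topological_space set"
  assumes "\<And>k. analytic_set (A k)"
  shows "analytic_set (\<Inter>k. A k)"
proof -
  obtain C :: "nat \<Rightarrow> ('a \<times> (nat \<Rightarrow> real)) set"
    where C: "\<And>k. closed (C k)" "\<And>k. A k = fst ` C k"
    using assms unfolding analytic_set_def by metis
  define E where "E = (\<Inter>k. {p :: 'a \<times> (nat \<Rightarrow> real). (fst p, \<lambda>i. snd p (prod_encode (k, i))) \<in> C k})"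
  have "closed E" unfolding E_def by (intro closed_INT ballI closed_reindex C)
  moreover have "(\<Inter>k. A k) = fst ` E"
  proof (intro equalityI subsetI)
    fix y assume "y \<in> (\<Inter>k. A k)"
    then have "\<forall>k. \<exists>x. (y, x) \<in> C k" using C(2) by force
    then obtain x where x: "\<And>k. (y, x k) \<in> C k" by metis
    have "(y, \<lambda>n. x (fst (prod_decode n)) (snd (prod_decode n))) \<in> E"
      using x by (simp add: E_def)
    then show "y \<in> fst ` E" by force
  next
    fix y assume "y \<in> fst ` E"
    then show "y \<in> (\<Inter>k. A k)" using C(2) by (force simp: E_def)
  qed
  ultimately show ?thesis unfolding analytic_set_def by blast
qed

text \<open>The induction carries a set together with its complement: complementation then merely
  swaps the two, and countable unions need stability under both unions and intersections.\<close>

lemma borel_imp_analytic_set: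
  fixes A :: "'a::metric_space set"
  assumes "A \<in> sets borel"
  shows "analytic_set A"
proof -
  have "A \<in> sigma_sets UNIV {S. closed S}"
    using assms unfolding borel_eq_closed by simp
  then have "analytic_set A \<and> analytic_set (- A)"
  proof induction
    case (Basic a)
    then show ?case by (auto intro: closed_imp_analytic_set open_imp_analytic_set)
  next
    case Empty
    then show ?case by (auto intro: closed_imp_analytic_set)
  next
    case (Compl a)
    then show ?case by (simp add: Compl_eq_Diff_UNIV[symmetric])
  next
    case (Union a)
    then show ?case by (auto simp: Compl_UN intro: analytic_set_UN analytic_set_INT)
  qed
  then show ?thesis ..
qed

section \<open>Packing dimension of projections\<close>

lemma AE_packing_dim_projection_ge:
  fixes F :: "(real^'n) set" and \<gamma> :: "(real^'n) set measure"
  assumes inv: "invariant_grassmann_measure m \<gamma>" and F: "F \<in> sets borel" "F \<noteq> {}"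
    and \<theta>: "0 < \<theta>" "\<theta> < 1" and s: "ereal s < packing_dim F"
  shows "AE V in \<gamma>. ereal s - Delta m \<theta> F \<le> packing_dim (orth_proj V ` F)"
proof -
  \<comment> \<open>By countable stability some bounded piece of \<open>F\<close> already has
    packing dimension above \<open>s\<close>.\<close>
  have "\<exists>i::nat. ereal s < packing_dim (F \<inter> cball 0 (real i))"
  proof (rule ccontr)
    assume "\<not> ?thesis"
    then have "packing_dim (\<Union>i::nat. F \<inter> cball 0 (real i)) \<le> ereal s"
      by (intro packing_dim_UN_le) (auto simp: not_less)
    moreover have "(\<Union>i::nat. F \<inter> cball 0 (real i)) = F"
      using real_arch_simple by auto
    ultimately show False using s by simp
  qed
  then obtain i :: nat where i: "ereal s < packing_dim (F \<inter> cball 0 (real i))" by blast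
  \<comment> \<open>Enlarging the ball to reach a point of \<open>F\<close> makes the piece visibly
    non-empty.\<close>
  obtain x where x: "x \<in> F" using F(2) by blast
  obtain j :: nat where j: "norm x \<le> real j" using real_arch_simple by blast
  define A where "A = F \<inter> cball 0 (real (max i j))"
  have "F \<inter> cball 0 (real i) \<subseteq> A" by (auto simp: A_def)
  then have sA: "ereal s < packing_dim A" using i packing_dim_mono by (metis order_less_le_trans)
  have Ane: "A \<noteq> {}" using x j by (auto simp: A_def)
  have "A \<in> sets borel" using F by (simp add: A_def)
  then obtain C :: "((real^'n) \<times> (nat \<Rightarrow> real)) set" where C: "closed C" "A = fst ` C"
    using borel_imp_analytic_set unfolding analytic_set_def by metis
  obtain \<B> :: "((real^'n) \<times> (nat \<Rightarrow> real)) set set" where \<B>: "countable \<B>" "topological_basis \<B>"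
    using ex_countable_basis by blast
  have openB: "open U" if "U \<in> \<B>" for U using topological_basis_open[OF \<B>(2) that] .
  \<comment> \<open>Deleting from \<open>C\<close> the basic open sets with small projection leaves a Polish space \<open>T\<close> all of whose
    non-empty relatively open pieces have a large projection.\<close>
  define \<U> where "\<U> = {U \<in> \<B>. packing_dim (fst ` (C \<inter> U)) \<le> ereal s}"
  have c\<U>: "countable \<U>" using \<B>(1) by (auto simp: \<U>_def)
  define T where "T = C - \<Union>\<U>"
  have closedT: "closed T" unfolding T_def using openB by (intro closed_Diff C open_Union) (auto simp: \<U>_def)
  \<comment> \<open>Passing from \<open>C\<close> to \<open>T\<close> removes countably many sets
    with small projections, so by countable stability a small projection of the
    \<open>T\<close>-part forces one of the \<open>C\<close>-part.\<close>
  have small: "packing_dim (fst ` (C \<inter> U)) \<le> ereal s" if "packing_dim (fst ` (T \<inter> U)) \<le> ereal s" for U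
  proof -
    have "fst ` (C \<inter> U) \<subseteq> (\<Union>W\<in>insert (T \<inter> U) ((\<inter>) C ` \<U>). fst ` W)"
      by (auto simp: T_def)
    then have "packing_dim (fst ` (C \<inter> U)) \<le> packing_dim (\<Union>W\<in>insert (T \<inter> U) ((\<inter>) C ` \<U>). fst ` W)"
      by (rule packing_dim_mono)
    also have "\<dots> \<le> ereal s"
      using c\<U> that by (intro packing_dim_countable_UN_le) (auto simp: \<U>_def)
    finally show ?thesis .
  qed
  have big: "ereal s < packing_dim (fst ` (T \<inter> U))" if "U \<in> \<B>" "T \<inter> U \<noteq> {}" for U
  proof (rule ccontr)
    assume "\<not> ?thesis"
    then have "U \<in> \<U>" using small[of U] that by (simp add: \<U>_def not_less)
    then show False using that(2) by (auto simp: T_def)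
  qed
  have Tne: "T \<noteq> {}"
  proof
    assume "T = {}"
    then have CU: "C \<subseteq> \<Union>\<U>" by (auto simp: T_def)
    have "\<U> \<noteq> {}" using CU C(2) Ane by auto
    moreover have "A = (\<Union>U\<in>\<U>. fst ` (C \<inter> U))" using CU C(2) by blast
    moreover have "packing_dim (fst ` (C \<inter> U)) \<le> ereal s" if "U \<in> \<U>" for U using that by (simp add: \<U>_def)
    ultimately have "packing_dim A \<le> ereal s" using packing_dim_countable_UN_le[OF c\<U>] by metis
    then show False using sA by simp
  qed
  note space = invariant_grassmann_measureD(3)[OF inv]
  define E where "E U = fst ` (T \<inter> U)" for U
  have EF: "E U \<subseteq> A" for U using C(2) by (auto simp: E_def T_def)
  have bddE: "bounded (E U)" for U using EF[of U] by (rule bounded_subset[rotated]) (simp add: A_def bounded_Int)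
  \<comment> \<open>The null set is fixed here through the countable basis, before any cover of the
    projection is given; the later choice of \<open>K\<close> may then depend on
    \<open>V\<close>.\<close>
  have "AE V in \<gamma>. \<forall>U\<in>\<B>. T \<inter> U \<noteq> {} \<longrightarrow> ereal s - Delta m \<theta> F \<le> upper_box_dim (orth_proj V ` E U)"
    unfolding AE_ball_countable[OF \<B>(1)]
  proof
    fix U assume U: "U \<in> \<B>"
    show "AE V in \<gamma>. T \<inter> U \<noteq> {} \<longrightarrow> ereal s - Delta m \<theta> F \<le> upper_box_dim (orth_proj V ` E U)"
    proof (cases "T \<inter> U = {}")
      case False
      then have ne: "E U \<noteq> {}" by (auto simp: E_def)
      have "ereal s \<le> upper_box_dim (E U)"
        using big[OF U False] packing_dim_le_upper_box_dim[OF bddE ne] by (simp add: E_def)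
      moreover have "Delta m \<theta> (E U) \<le> Delta m \<theta> F"
        using EF[of U] \<theta> by (intro Delta_mono) (auto simp: A_def)
      ultimately have "ereal s - Delta m \<theta> F \<le> upper_box_dim (E U) - Delta m \<theta> (E U)"
        by (rule ereal_minus_mono)
      with AE_box_dim_projection[OF inv bddE ne \<theta>] show ?thesis
        by (elim AE_mp, intro AE_I2) (auto intro: order_trans)
    qed simp
  qed
  then show ?thesis
  proof (rule AE_mp, intro AE_I2 impI)
    fix V assume V: "V \<in> space \<gamma>"
      and box: "\<forall>U\<in>\<B>. T \<inter> U \<noteq> {} \<longrightarrow> ereal s - Delta m \<theta> F \<le> upper_box_dim (orth_proj V ` E U)"
    have "subspace V" using V by (simp add: space grassmannian_def)
    then have "linear (orth_proj V)" by (rule linear_orth_proj)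
    then have contV: "continuous_on UNIV (orth_proj V)"
      by (intro linear_continuous_on) (simp add: linear_conv_bounded_linear)
    show "ereal s - Delta m \<theta> F \<le> packing_dim (orth_proj V ` F)"
      unfolding packing_dim_def
    proof (rule Inf_greatest, clarify)
      fix K :: "nat \<Rightarrow> (real^'n) set"
      assume K: "\<forall>j. compact (K j) \<and> K j \<noteq> {}" "orth_proj V ` F \<subseteq> (\<Union>j. K j)"
      \<comment> \<open>These closed sets cover \<open>T\<close>, so by Baire's theorem one of them
        has non-empty relative interior.\<close>
      define T' where "T' j = T \<inter> (\<lambda>p. orth_proj V (fst p)) -` K j" for j
      have closedT': "closedin (top_of_set T) (T' j)" for j
      proof -
        have "closed ((\<lambda>p :: (real^'n) \<times> (nat \<Rightarrow> real). orth_proj V (fst p)) -` K j)"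
          using K(1) compact_imp_closed
          by (intro closed_vimage continuous_on_compose2[OF contV] continuous_on_fst continuous_on_id) auto
        then show ?thesis unfolding T'_def by (rule closedin_closed_Int)
      qed
      have "completely_metrizable_space (top_of_set T)"
        using closedT completely_metrizable_space_closedin completely_metrizable_space_euclidean
          closed_closedin by blast
      then have "top_of_set T interior_of \<Union>(range T') = {}" if "\<And>j. top_of_set T interior_of T' j = {}"
        using that closedT' by (intro Baire_category_alt) auto
      moreover have "\<Union>(range T') = topspace (top_of_set T)"
      proof -
        have "orth_proj V (fst p) \<in> (\<Union>j. K j)" if "p \<in> T" for p
        proof -
          have "fst p \<in> A" using that by (simp add: T_def C(2))
          then show ?thesis using K(2) by (auto simp: A_def)
        qed
        then show ?thesis by (auto simp: T'_def)
      qed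
      moreover have "top_of_set T interior_of topspace (top_of_set T) \<noteq> {}"
        using Tne interior_of_topspace[of "top_of_set T"] by simp
      ultimately obtain j p where p: "p \<in> top_of_set T interior_of T' j" by fastforce
      then obtain G where "openin (top_of_set T) G" "p \<in> G" "G \<subseteq> T' j"
        by (auto simp: interior_of_def)
      then obtain O' where O': "open O'" "p \<in> T \<inter> O'" "T \<inter> O' \<subseteq> T' j" by (auto simp: openin_open)
      \<comment> \<open>Shrinking to a basis set makes the almost sure bound \<open>box\<close>
        applicable, while the projection of \<open>E U\<close> still lies in
        \<open>K j\<close>.\<close>
      obtain U where U: "U \<in> \<B>" "p \<in> U" "U \<subseteq> O'"
        using topological_basisE[OF \<B>(2) O'(1), of p] O'(2) by blast
      have ne: "T \<inter> U \<noteq> {}" using U O' by blast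
      have "orth_proj V ` E U \<subseteq> K j" using U(3) O'(3) by (auto simp: E_def T'_def)
      then have "upper_box_dim (orth_proj V ` E U) \<le> upper_box_dim (K j)"
        using K(1) ne by (intro upper_box_dim_mono) (auto simp: E_def compact_imp_bounded)
      also have "\<dots> \<le> (SUP j. upper_box_dim (K j))" by (rule SUP_upper) simp
      finally show "ereal s - Delta m \<theta> F \<le> (SUP j. upper_box_dim (K j))"
        using box U(1) ne by (meson order_trans)
    qed
  qed
qed

text \<open>Letting \<open>s\<close> run through the rationals below \<open>packing_dim F\<close>
  needs only countably many null sets, and density of the rationals recovers the full value.\<close>

lemma AE_packing_dim_projection:
  fixes F :: "(real^'n) set" and \<gamma> :: "(real^'n) set measure"
  assumes inv: "invariant_grassmann_measure m \<gamma>" and F: "F \<in> sets borel" "F \<noteq> {}"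
    and \<theta>: "0 < \<theta>" "\<theta> < 1"
  shows "AE V in \<gamma>. packing_dim F - Delta m \<theta> F \<le> packing_dim (orth_proj V ` F)"
proof -
  obtain \<delta> where \<delta>: "Delta m \<theta> F = ereal \<delta>" using Delta_finite[OF \<theta>(2)] .
  have "AE V in \<gamma>. \<forall>q::rat. ereal (of_rat q) < packing_dim F \<longrightarrow>
          ereal (of_rat q) - Delta m \<theta> F \<le> packing_dim (orth_proj V ` F)"
    unfolding AE_all_countable
  proof
    fix q :: rat
    show "AE V in \<gamma>. ereal (of_rat q) < packing_dim F \<longrightarrow>
            ereal (of_rat q) - Delta m \<theta> F \<le> packing_dim (orth_proj V ` F)"
      using AE_packing_dim_projection_ge[OF inv F \<theta>, of "of_rat q"]
      by (cases "ereal (of_rat q) < packing_dim F") auto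
  qed
  then show ?thesis
  proof (rule AE_mp, intro AE_I2 impI)
    fix V assume q: "\<forall>q::rat. ereal (of_rat q) < packing_dim F \<longrightarrow>
          ereal (of_rat q) - Delta m \<theta> F \<le> packing_dim (orth_proj V ` F)"
    have "packing_dim F \<le> packing_dim (orth_proj V ` F) + ereal \<delta>"
    proof (rule dense_le)
      fix t assume "t < packing_dim F"
      then obtain r :: rat where r: "t < ereal (of_rat r)" "ereal (of_rat r) < packing_dim F"
        using ereal_dense3 by blast
      then have "ereal (of_rat r) - ereal \<delta> \<le> packing_dim (orth_proj V ` F)" using q \<delta> by auto
      then have "ereal (of_rat r) \<le> packing_dim (orth_proj V ` F) + ereal \<delta>"
        by (cases "packing_dim (orth_proj V ` F)") auto
      then show "t \<le> packing_dim (orth_proj V ` F) + ereal \<delta>" using r(1) by order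
    qed
    then show "packing_dim F - Delta m \<theta> F \<le> packing_dim (orth_proj V ` F)"
      unfolding \<delta> by (cases "packing_dim F"; cases "packing_dim (orth_proj V ` F)") auto
  qed
qed

theorem theorem1p1:
  fixes F :: "(real^'n) set" and m :: nat and \<theta> :: real
    and \<gamma> :: "(real^'n) set measure"
  assumes "1 \<le> m" and "m < CARD('n)"
    and "0 < \<theta>" and "\<theta> < 1"
    and "F \<noteq> {}"
    and "invariant_grassmann_measure m \<gamma>"
  shows "(bounded F \<longrightarrow>
            (AE V in \<gamma>. upper_box_dim (orth_proj V ` F) \<ge> upper_box_dim F - Delta m \<theta> F) \<and>
            (AE V in \<gamma>. lower_box_dim (orth_proj V ` F) \<ge> lower_box_dim F - Delta m \<theta> F)) \<and>
         (F \<in> sets borel \<longrightarrow>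
            (AE V in \<gamma>. packing_dim (orth_proj V ` F) \<ge> packing_dim F - Delta m \<theta> F))"
  using AE_box_dim_projection[OF assms(6) _ assms(5,3,4)]
    AE_packing_dim_projection[OF assms(6) _ assms(5,3,4)]
  by simp

end
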